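(* Let $H_L:\mathcal{L}_2^n\to\mathcal{L}_2^n$ be the LTI system $\dot x(t)=Ax(t)+Bu(t)$, $x(0)=0$, $y(t)=Cx(t)+Du(t)$, with state $x(t)\in\mathbb{R}^m$, input $u(t)\in\mathbb{R}^n$ and output $y(t)\in\mathbb{R}^n$, and assume that $A$ is Hurwitz. Let $\Pi\in\mathbb{S}^2$ and $$\Theta(\Pi)=\begin{bmatrix} C & D \\ 0 & I\end{bmatrix}^\top(\Pi\otimes I_n)\begin{bmatrix} C & D \\ 0 & I\end{bmatrix}.$$ Consider the following statements. (1) There exists a matrix $P\in\mathbb{S}^m$ such that $$\begin{bmatrix} A & B \\ I & 0\end{bmatrix}^\top\begin{bmatrix} 0 & P \\ P & 0\end{bmatrix}\begin{bmatrix} A & B \\ I & 0\end{bmatrix}-\Theta(\Pi)\preceq 0.$$ (2) For all $u\in\mathcal{L}_2^n$ and $y=H_L(u)$, $$\int_0^\infty \begin{bmatrix} y(t) \\ u(t)\end{bmatrix}^\top(\Pi\otimes I_n)\begin{bmatrix} y(t) \\ u(t)\end{bmatrix}dt\ge 0.$$ (3) $\mathrm{SG}(H_L)\subset\mathcal{S}(\Pi)$. Then (1) implies (2), (1) implies (3), and (2) is equivalent to (3). If the pair $(A,B)$ is controllable, all three statements are equivalent.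
   Context: $\mathbb{S}^k$ is the set of real symmetric $k\times k$ matrices; $\preceq 0$ means negative semidefinite; $\otimes$ is the Kronecker product. A real square matrix is Hurwitz if all its eigenvalues have strictly negative real part. $\mathcal{L}_2^n$ is the space of square-integrable functions $u:\mathbb{R}_{\ge0}\to\mathbb{R}^n$ with $\langle u,y\rangle=\int_0^\infty u(t)^\top y(t)\,dt$ and $\|u\|=\sqrt{\langle u,u\rangle}$. Standing assumption in the paper: the realization $(A,B,C,D)$ is minimal. Scaled graph: for $u\neq 0$ and $y=H_L(u)$, put $\rho(u,y)=\|y\|/\|u\|$ and $\theta(u,y)=\arccos\frac{\langle u,y\rangle}{\|u\|\|y\|}\in[0,\pi]$ if $y\ne0$, $\theta(u,y)=0$ if $y=0$. Then $$\mathrm{SG}(H_L)=\{\rho(u,y)e^{\pm j\theta(u,y)} \mid u\in\mathcal{L}_2^n\setminus\{0\},\ y=H_L(u)\}\subset\mathbb{C}$$ (both signs are included). For $\Pi\in\mathbb{S}^2$, $\mathcal{S}(\Pi)=\left\{z\in\mathbb{C}\;\middle|\;\begin{bmatrix} z \\ 1\end{bmatrix}^*\Pi\begin{bmatrix} z \\ 1\end{bmatrix}\ge0\right\}$, where $*$ is conjugate transpose. *)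

theory Defs
  imports "HOL-Analysis.Analysis"
begin

section \<open>Matrices\<close>

definition sym_mat :: "real^'k^'k \<Rightarrow> bool" where
  "sym_mat M \<longleftrightarrow> transpose M = M"

definition neg_semidef :: "real^'k^'k \<Rightarrow> bool" where
  "neg_semidef M \<longleftrightarrow> sym_mat M \<and> (\<forall>v. v \<bullet> (M *v v) \<le> 0)"

text \<open>The eigenvalues of a real matrix are those of its complexification.\<close>

definition hurwitz :: "real^'k^'k \<Rightarrow> bool" where
  "hurwitz M \<longleftrightarrow>
     (\<forall>(l::complex) v. v \<noteq> 0 \<and> map_matrix complex_of_real M *v v = l *s v \<longrightarrow> Re l < 0)"

text \<open>\<open>block_mat M N K L\<close> is the block matrix with rows \<open>(M N)\<close> and \<open>(K L)\<close>; rows and columns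
  of the result are indexed by sum types.\<close>

definition block_mat ::
  "real^'a^'c \<Rightarrow> real^'b^'c \<Rightarrow> real^'a^'d \<Rightarrow> real^'b^'d \<Rightarrow> real^('a + 'b)^('c + 'd)" where
  "block_mat M N K L = (\<chi> i j.
     case i of
       Inl p \<Rightarrow> (case j of Inl q \<Rightarrow> M $ p $ q | Inr q \<Rightarrow> N $ p $ q)
     | Inr p \<Rightarrow> (case j of Inl q \<Rightarrow> K $ p $ q | Inr q \<Rightarrow> L $ p $ q))"

definition block_vec :: "real^'a \<Rightarrow> real^'b \<Rightarrow> real^('a + 'b)" where
  "block_vec v w = (\<chi> i. case i of Inl p \<Rightarrow> v $ p | Inr q \<Rightarrow> w $ q)"

text \<open>The Kronecker product with a \<open>2 \<times> 2\<close> left factor: the block matrix with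
  blocks \<open>Q\<^sub>i\<^sub>j M\<close>.\<close>

definition kron2 :: "real^2^2 \<Rightarrow> real^'b^'a \<Rightarrow> real^('b + 'b)^('a + 'a)" where
  "kron2 Q M = block_mat ((Q $ 1 $ 1) *\<^sub>R M) ((Q $ 1 $ 2) *\<^sub>R M)
                          ((Q $ 2 $ 1) *\<^sub>R M) ((Q $ 2 $ 2) *\<^sub>R M)"

section \<open>Square-integrable signals\<close>

text \<open>Signals on \<open>{0..}\<close> are represented by functions on the whole real line, whose values at
  negative times are irrelevant. Elements are functions, not equivalence classes, so ``nonzero
  in \<open>L\<^sub>2\<close>'' has to be expressed as \<open>l2_norm u \<noteq> 0\<close>.\<close>

definition L2 :: "(real \<Rightarrow> real^'k) set" where
  "L2 = {u. u \<in> borel_measurable (lebesgue_on {0..}) \<and>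
            integrable (lebesgue_on {0..}) (\<lambda>t. (norm (u t))\<^sup>2)}"

definition l2_inner :: "(real \<Rightarrow> real^'k) \<Rightarrow> (real \<Rightarrow> real^'k) \<Rightarrow> real" where
  "l2_inner u y = (LINT t | lebesgue_on {0..}. u t \<bullet> y t)"

definition l2_norm :: "(real \<Rightarrow> real^'k) \<Rightarrow> real" where
  "l2_norm u = sqrt (l2_inner u u)"

section \<open>Linear time-invariant systems\<close>

text \<open>Inputs are merely square integrable, so solutions of \<open>x' = A x + B u\<close>, \<open>x 0 = x0\<close> are
  understood in the sense of Caratheodory, i.e. through the integral equation.\<close>

definition lti_trajectory ::
  "real^'m^'m \<Rightarrow> real^'n^'m \<Rightarrow> real^'m \<Rightarrow> (real \<Rightarrow> real^'n) \<Rightarrow> (real \<Rightarrow> real^'m) \<Rightarrow> bool" where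
  "lti_trajectory A B x0 u x \<longleftrightarrow>
     (\<forall>t\<ge>0. ((\<lambda>s. A *v x s + B *v u s) has_integral (x t - x0)) {0..t})"

text \<open>For square-integrable \<open>u\<close> the trajectory exists and is unique on \<open>{0..}\<close>, so the choice
  below only concerns negative times.\<close>

definition lti_state :: "real^'m^'m \<Rightarrow> real^'n^'m \<Rightarrow> (real \<Rightarrow> real^'n) \<Rightarrow> real \<Rightarrow> real^'m" where
  "lti_state A B u = (SOME x. lti_trajectory A B 0 u x)"

definition lti_system ::
  "real^'m^'m \<Rightarrow> real^'n^'m \<Rightarrow> real^'m^'p \<Rightarrow> real^'n^'p \<Rightarrow> (real \<Rightarrow> real^'n) \<Rightarrow> real \<Rightarrow> real^'p" where
  "lti_system A B C D u t = C *v lti_state A B u t + D *v u t"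

definition controllable :: "real^'m^'m \<Rightarrow> real^'n^'m \<Rightarrow> bool" where
  "controllable A B \<longleftrightarrow>
     (\<forall>x0 x1. \<exists>T>0. \<exists>u\<in>L2. \<exists>x. lti_trajectory A B x0 u x \<and> x T = x1)"

text \<open>Minimality: no realization of the same input-output map has a smaller state dimension.
  Since dimensions are types, a competing realization of order \<open>k \<le> CARD('m)\<close> is encoded as one
  whose state space is a \<open>k\<close>-dimensional subspace \<open>V\<close> of \<open>real^'m\<close>; this covers all realizations
  of order at most \<open>CARD('m)\<close> up to a change of coordinates, \<open>k = 0\<close> included.\<close>

definition minimal_realization ::
  "real^'m^'m \<Rightarrow> real^'n^'m \<Rightarrow> real^'m^'p \<Rightarrow> real^'n^'p \<Rightarrow> bool" where
  "minimal_realization A B C D \<longleftrightarrow>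
     (\<forall>(V::(real^'m) set) (A'::real^'m^'m) (B'::real^'n^'m) (C'::real^'m^'p) (D'::real^'n^'p).
        subspace V \<and> (\<forall>v\<in>V. A' *v v \<in> V) \<and> (\<forall>w. B' *v w \<in> V) \<and>
        (\<forall>u\<in>L2. \<forall>t\<ge>0. lti_system A' B' C' D' u t = lti_system A B C D u t)
        \<longrightarrow> CARD('m) \<le> dim V)"

section \<open>Scaled graphs\<close>

definition sg_gain :: "(real \<Rightarrow> real^'n) \<Rightarrow> (real \<Rightarrow> real^'n) \<Rightarrow> real" where
  "sg_gain u y = l2_norm y / l2_norm u"

definition sg_angle :: "(real \<Rightarrow> real^'n) \<Rightarrow> (real \<Rightarrow> real^'n) \<Rightarrow> real" where
  "sg_angle u y =
     (if l2_norm y = 0 then 0 else arccos (l2_inner u y / (l2_norm u * l2_norm y)))"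

definition scaled_graph :: "((real \<Rightarrow> real^'n) \<Rightarrow> real \<Rightarrow> real^'n) \<Rightarrow> complex set" where
  "scaled_graph H =
     {z. \<exists>u\<in>L2. l2_norm u \<noteq> 0 \<and>
           (z = rcis (sg_gain u (H u)) (sg_angle u (H u)) \<or>
            z = rcis (sg_gain u (H u)) (- sg_angle u (H u)))}"

text \<open>The Hermitian form of the complex vector \<open>(z, 1)\<close>. Its value is a real number for symmetric
  \<open>Q\<close>, so taking the real part loses nothing.\<close>

definition S_region :: "real^2^2 \<Rightarrow> complex set" where
  "S_region Q =
     {z. let v = (vector [z, 1] :: complex^2)
         in Re (\<Sum>i\<in>UNIV. \<Sum>j\<in>UNIV. cnj (v $ i) * complex_of_real (Q $ i $ j) * v $ j) \<ge> 0}"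

section \<open>The three conditions\<close>

definition Theta :: "real^'m^'n \<Rightarrow> real^'n^'n \<Rightarrow> real^2^2 \<Rightarrow> real^('m + 'n)^('m + 'n)" where
  "Theta C D Q =
     transpose (block_mat C D 0 (mat 1)) ** kron2 Q (mat 1) ** block_mat C D 0 (mat 1)"

definition lmi_feasible ::
  "real^'m^'m \<Rightarrow> real^'n^'m \<Rightarrow> real^'m^'n \<Rightarrow> real^'n^'n \<Rightarrow> real^2^2 \<Rightarrow> bool" where
  "lmi_feasible A B C D Q \<longleftrightarrow>
     (\<exists>P::real^'m^'m. sym_mat P \<and>
        neg_semidef (transpose (block_mat A B (mat 1) 0) ** block_mat 0 P P 0
                       ** block_mat A B (mat 1) 0 - Theta C D Q))"

definition iqc_holds :: "((real \<Rightarrow> real^'n) \<Rightarrow> real \<Rightarrow> real^'n) \<Rightarrow> real^2^2 \<Rightarrow> bool" where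
  "iqc_holds H Q \<longleftrightarrow>
     (\<forall>u\<in>L2. (LINT t | lebesgue_on {0..}.
        block_vec (H u t) (u t) \<bullet> (kron2 Q (mat 1) *v block_vec (H u t) (u t))) \<ge> 0)"

end

(* The matrix inequality says that the storage x^T P x grows along trajectories at most at the supply
   rate w = [y; u]^T (Pi (x) I) [y; u].  Integrating this for a square integrable input and using that
   the state is square integrable (A is Hurwitz) gives (1) ==> (2).  The integral in (2), divided by
   |u|^2, is the quadratic form defining S(Pi) at the points of the scaled graph that come from u,
   whence (2) <=> (3).  For (2) ==> (1), following Willems, let S(x0) be the infimum of the integral of w
   over all square integrable inputs, starting from x0.  It is bounded below since x0 is reached from the
   origin, where all costs are nonnegative, and it is a quadratic form by the parallelogram identity.  The
   principle of optimality S(x0) <= int_0^T w + S(x(T)), differentiated at T = 0, is the matrix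
   inequality for P = -S. *)

theory Submission
  imports Defs "HOL-Computational_Algebra.Fundamental_Theorem_Algebra"
begin

section \<open>A quadratic Lyapunov function\<close>

text \<open>Inputs are merely square integrable, so states are only absolutely continuous and the
  chain rule for \<open>x \<bullet> (P *v x)\<close> holds only almost everywhere. Its integrated
  form is proved once, for symmetric bilinear forms, and serves both stability and dissipation.
  Stability rests on a quadratic Lyapunov function instead of estimates of the matrix exponential.
  It is assembled from a vanishing product of factors A - l with Re l < 0, so eigenvalues enter
  without a normal form. It bounds the state in L2 by the initial state and the input, which makes
  every cost finite. In (1) ==> (2) the matrix P may be indefinite, so the boundary term at T has no
  sign; square integrability of x has to make it small for suitable large T. In (2) ==> (1) the
  infimum need not be attained. Its algebraic laws are inherited from operations on single costs,
  which yield only inequalities; the inverse operations supply the converse ones. The principle of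
  optimality is differentiated along continuous test inputs, for which x and the running cost are
  differentiable at 0. Inputs of norm zero have no point in the scaled graph but occur in (2); a
  bound on the cost settles them.\<close>

definition linear_factors :: "complex^'m^'m \<Rightarrow> complex list \<Rightarrow> complex^'m \<Rightarrow> complex^'m" where
  "linear_factors M ls v = foldr (\<lambda>l w. M *v w - l *s w) ls v"

lemma linear_factors_simps [simp]:
  "linear_factors M [] v = v"
  "linear_factors M (l # ls) v = M *v linear_factors M ls v - l *s linear_factors M ls v"
  by (simp_all add: linear_factors_def)

lemma matrix_vector_mult_smult: "M *v (c *s v) = c *s (M *v (v::'a::comm_ring_1^'m))"
  by (simp add: vec_eq_iff matrix_vector_mult_def sum_distrib_left algebra_simps)

lemma linear_factors_add:
  "linear_factors M ls (v + w) = linear_factors M ls v + linear_factors M ls w"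
  by (induction ls) (simp_all add: matrix_vector_right_distrib vec.scale_right_distrib)

lemma linear_factors_diff:
  "linear_factors M ls (v - w) = linear_factors M ls v - linear_factors M ls w"
  by (induction ls) (simp_all add: matrix_vector_mult_diff_distrib vec.scale_right_diff_distrib)

lemma linear_factors_smult:
  "linear_factors M ls (c *s v) = c *s linear_factors M ls v"
  by (induction ls) (simp_all add: matrix_vector_mult_smult vec.scale_right_diff_distrib mult.commute)

lemmas linear_factors_linear = linear_factors_add linear_factors_diff linear_factors_smult

text \<open>The product is a polynomial in \<open>M\<close>. This allows an outermost factor to be
  moved inside, and a product to be followed along the flow of \<open>M\<close>.\<close>

lemma linear_factors_commute: "linear_factors M ls (M *v v) = M *v linear_factors M ls v"
  by (induction ls) (simp_all add: matrix_vector_mult_diff_distrib matrix_vector_mult_smult)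

definition poly_mat :: "complex^'m^'m \<Rightarrow> complex poly \<Rightarrow> complex^'m \<Rightarrow> complex^'m" where
  "poly_mat M p v = (\<Sum>i\<le>degree p. coeff p i *s ((*v) M ^^ i) v)"

lemma poly_mat_altdef:
  assumes "degree p \<le> n"
  shows "poly_mat M p v = (\<Sum>i\<le>n. coeff p i *s ((*v) M ^^ i) v)"
  unfolding poly_mat_def
  by (rule sum.mono_neutral_left) (use assms in \<open>auto simp: coeff_eq_0 not_le\<close>)

lemma scaleR_eq_smult: "r *\<^sub>R v = complex_of_real r *s v" for v :: "complex^'m"
  by (simp add: vec_eq_iff scaleR_conv_of_real[symmetric])

lemma scaleR_matrix_vector_mult: "(r *\<^sub>R M) *v v = r *\<^sub>R (M *v v)"
  for M :: "'a::real_algebra_1^'m^'k"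
  by (simp add: vec_eq_iff matrix_vector_mult_def scaleR_sum_right)

lemma matrix_vector_mult_sum: "M *v (\<Sum>i\<in>I. f i) = (\<Sum>i\<in>I. M *v f i)"
  for M :: "'a::comm_ring_1^'m^'k"
  by (induction I rule: infinite_finite_induct) (simp_all add: matrix_vector_right_distrib)

lemma poly_mat_mult_linear:
  "poly_mat M ([:-l, 1:] * p) v = M *v poly_mat M p v - l *s poly_mat M p v"
proof -
  \<comment> \<open>A common summation bound for \<open>p\<close> and \<open>pCons 0 p\<close>:
    coefficients beyond the degree vanish, so all sums can run over the same range.\<close>
  let ?n = "Suc (degree p)"
  have *: "[:-l, 1:] * p = pCons 0 p - smult l p" by simp
  have "poly_mat M (pCons 0 p - smult l p) v
      = (\<Sum>i\<le>?n. coeff (pCons 0 p) i *s ((*v) M ^^ i) v - l *s (coeff p i *s ((*v) M ^^ i) v))"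
    by (subst poly_mat_altdef[of _ ?n])
      (auto intro!: degree_diff_le degree_pCons_le order.trans[OF degree_smult_le] sum.cong
        simp: vec_eq_iff algebra_simps)
  also have "\<dots> = (\<Sum>i\<le>?n. coeff (pCons 0 p) i *s ((*v) M ^^ i) v)
                - l *s (\<Sum>i\<le>?n. coeff p i *s ((*v) M ^^ i) v)"
    by (simp add: sum_subtractf vec.scale_sum_right)
  also have "(\<Sum>i\<le>?n. coeff p i *s ((*v) M ^^ i) v) = poly_mat M p v"
    by (subst poly_mat_altdef[of _ ?n]) auto
  also have "(\<Sum>i\<le>?n. coeff (pCons 0 p) i *s ((*v) M ^^ i) v) = M *v poly_mat M p v"
    by (simp add: poly_mat_def sum.atMost_Suc_shift matrix_vector_mult_sum matrix_vector_mult_smult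
        del: sum.atMost_Suc)
  finally show ?thesis by (simp only: *)
qed

lemma poly_mat_prod_list:
  "poly_mat M (prod_list (map (\<lambda>l. [:-l, 1:]) ls)) v = linear_factors M ls v"
proof (induction ls)
  case Nil
  show ?case by (simp add: poly_mat_def)
next
  case (Cons l ls)
  then show ?case
    by (simp only: list.map prod_list.Cons poly_mat_mult_linear linear_factors_simps)
qed

text \<open>A dimension count: the powers of \<open>M\<close> up to the real dimension of the matrix
  space are one too many to be independent. The coefficients of the relation are real and are then
  read as complex ones.\<close>

lemma annihilating_polynomial:
  fixes M :: "complex^'m^'m"
  obtains p where "p \<noteq> 0" "\<And>v. poly_mat M p v = 0"
proof -
  define pow where "pow k = ((**) M ^^ k) (mat 1)" for k
  have pow: "pow k *v v = ((*v) M ^^ k) v" for k v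
    by (induction k) (simp_all add: pow_def matrix_vector_mul_assoc[symmetric])
  let ?n = "DIM(complex^'m^'m)"
  have "\<exists>c. (\<exists>k\<le>?n. c k \<noteq> 0) \<and> (\<Sum>k\<le>?n. c k *\<^sub>R pow k) = 0"
  proof (cases "inj_on pow {..?n}")
    case True
    then have "card (pow ` {..?n}) = Suc ?n" by (simp add: card_image)
    then have "dependent (pow ` {..?n})"
      using independent_bound[of "pow ` {..?n}"] by fastforce
    then obtain u where u: "\<exists>v\<in>pow ` {..?n}. u v \<noteq> 0" "(\<Sum>v\<in>pow ` {..?n}. u v *\<^sub>R v) = 0"
      by (auto simp: dependent_finite)
    then show ?thesis
      by (intro exI[of _ "u \<circ> pow"]) (auto simp: sum.reindex[OF True] simp del: DIM_cart)
  next
    case False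
    then obtain i j where ij: "i \<le> ?n" "j \<le> ?n" "i \<noteq> j" "pow i = pow j"
      by (auto simp: inj_on_def)
    \<comment> \<open>Dependence of the set of powers would not see a repetition; two equal powers
      give a relation directly.\<close>
    have "(\<Sum>k\<le>?n. (of_bool (k = i) - of_bool (k = j)) *\<^sub>R pow k) = pow i - pow j"
      using ij by (simp add: scaleR_diff_left sum_subtractf of_bool_def if_distrib[of "\<lambda>x. x *\<^sub>R _"]
          cong: if_cong)
    then show ?thesis
      using ij by (intro exI[of _ "\<lambda>k. of_bool (k = i) - of_bool (k = j)"]) auto
  qed
  then obtain c where c: "\<exists>k\<le>?n. c k \<noteq> 0" "(\<Sum>k\<le>?n. c k *\<^sub>R pow k) = 0" by blast
  define p where "p = (\<Sum>k\<le>?n. monom (complex_of_real (c k)) k)"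
  have coeff: "coeff p k = (if k \<le> ?n then complex_of_real (c k) else 0)" for k
    by (simp add: p_def coeff_sum)
  have "degree p \<le> ?n"
    by (intro degree_le) (simp add: coeff)
  then have "poly_mat M p v = (\<Sum>k\<le>?n. c k *\<^sub>R pow k) *v v" for v
  proof -
    have "(\<Sum>k\<in>I. c k *\<^sub>R pow k) *v v = (\<Sum>k\<in>I. complex_of_real (c k) *s ((*v) M ^^ k) v)" for I :: "nat set"
      by (induction I rule: infinite_finite_induct)
        (simp_all add: matrix_vector_mult_add_rdistrib scaleR_matrix_vector_mult pow
          scaleR_eq_smult[symmetric])
    then show ?thesis using \<open>degree p \<le> ?n\<close> by (simp add: poly_mat_altdef coeff)
  qed
  with c(2) have "poly_mat M p v = 0" for v by simp
  moreover from c(1) coeff have "p \<noteq> 0" by (metis coeff_0 of_real_eq_0_iff)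
  ultimately show ?thesis using that by blast
qed

text \<open>Factor an annihilating polynomial over the complex numbers. A root l with Re l \<ge> 0
  is no eigenvalue, so M - l is injective and its factor can be deleted without losing
  annihilation.\<close>

lemma hurwitz_annihilating_factors:
  fixes A :: "real^'m^'m"
  assumes "hurwitz A"
  obtains ls where "\<forall>l\<in>set ls. Re l < 0"
    "\<And>v. linear_factors (map_matrix complex_of_real A) ls v = 0"
proof -
  let ?M = "map_matrix complex_of_real A"
  obtain p where p: "p \<noteq> 0" "\<And>v. poly_mat ?M p v = 0"
    using annihilating_polynomial by blast
  obtain R where R: "p = smult (lead_coeff p) (\<Prod>x\<in>#R. [:-x, 1:])"
    using alg_closed_imp_factorization[OF p(1)] by blast
  obtain ls where "R = mset ls" by (metis ex_mset)
  then have pls: "p = smult (lead_coeff p) (prod_list (map (\<lambda>l. [:-l, 1:]) ls))"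
    using R by (simp add: prod_mset_prod_list[symmetric])
  have "lead_coeff p *s linear_factors ?M ls v = 0" for v
  proof -
    have "poly_mat ?M (smult (lead_coeff p) q) v = lead_coeff p *s poly_mat ?M q v" for q
      by (simp add: poly_mat_altdef[OF degree_smult_le] poly_mat_def vec.scale_sum_right)
    then show ?thesis using p(2) pls by (metis poly_mat_prod_list)
  qed
  then have ls: "linear_factors ?M ls v = 0" for v
    using p(1) by simp
  \<comment> \<open>Stated vector by vector, because the product over a proper tail of the list need
    not vanish on the whole space.\<close>
  have "\<exists>ls'. (\<forall>l\<in>set ls'. Re l < 0) \<and>
          (\<forall>v. linear_factors ?M ls v = 0 \<longrightarrow> linear_factors ?M ls' v = 0)" for ls
  proof (induction ls)
    case Nil
    show ?case by (intro exI[of _ "[]"]) simp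
  next
    case (Cons l ls)
    then obtain ls' where ls': "\<forall>l\<in>set ls'. Re l < 0"
        "\<And>v. linear_factors ?M ls v = 0 \<Longrightarrow> linear_factors ?M ls' v = 0" by blast
    show ?case
    proof (cases "Re l < 0")
      case True
      have "linear_factors ?M (l # ls') v = 0" if "linear_factors ?M (l # ls) v = 0" for v
      proof -
        \<comment> \<open>The retained factor is moved to the inside, so that the induction
          hypothesis applies to the vector (M - l) v.\<close>
        have "linear_factors ?M ls (?M *v v - l *s v) = 0"
          using that by (simp add: linear_factors_linear linear_factors_commute)
        then have "linear_factors ?M ls' (?M *v v - l *s v) = 0" by (rule ls')
        then show ?thesis by (simp add: linear_factors_linear linear_factors_commute)
      qed
      then show ?thesis using True ls'(1) by (intro exI[of _ "l # ls'"]) auto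
    next
      case False
      have "linear_factors ?M ls v = 0" if "linear_factors ?M (l # ls) v = 0" for v
        using that False assms unfolding hurwitz_def by (metis linear_factors_simps(2) eq_iff_diff_eq_0)
      then show ?thesis using ls' by blast
    qed
  qed
  then show ?thesis using ls that by blast
qed

lemma inner_smult_complex_self: "(l *s v) \<bullet> v = Re l * (norm v)\<^sup>2" for v :: "complex^'m"
proof -
  have "(l *s v) \<bullet> v = (\<Sum>i\<in>UNIV. Re l * (v $ i \<bullet> v $ i))"
    unfolding inner_vec_def by (intro sum.cong refl) (simp add: inner_complex_def algebra_simps)
  then show ?thesis
    by (simp add: inner_vec_def sum_distrib_left flip: power2_norm_eq_inner)
      (simp add: power2_norm_eq_inner inner_vec_def sum_distrib_left)
qed

text \<open>Each factor \<open>M - l\<close> adds the term \<open>k |N x|\<^sup>2\<close> to the Lyapunov function, where \<open>N\<close> is the product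
  of the previous factors: along \<open>x' = A x\<close> its derivative is at most
  \<open>k (Re l |N x|\<^sup>2 + |(M - l) N x|\<^sup>2 / |Re l|)\<close>, so that a large \<open>k\<close> replaces the error term in \<open>N x\<close>
  by one in \<open>(M - l) N x\<close>. The full product vanishes.\<close>

lemma lyapunov_form:
  fixes A :: "real^'m^'m"
  assumes "hurwitz A"
  obtains b :: "real^'m \<Rightarrow> real^'m \<Rightarrow> real" where
    "bilinear b" "\<And>x y. b x y = b y x" "\<And>x. b x x \<ge> 0" "\<And>x. 2 * b x (A *v x) \<le> - (norm x)\<^sup>2"
proof -
  let ?M = "map_matrix complex_of_real A"
  \<comment> \<open>The roots are complex although \<open>A\<close> is real. The embedding is
    real-linear and isometric, so norms of its images under the factors are real quadratic forms in
    \<open>x\<close>.\<close>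
  define emb :: "real^'m \<Rightarrow> complex^'m" where "emb x = (\<chi> i. complex_of_real (x $ i))" for x
  have emb_mult: "emb (A *v x) = ?M *v emb x" for x
    by (simp add: emb_def vec_eq_iff matrix_vector_mult_def)
  have lin: "linear (\<lambda>x. linear_factors ?M ls (emb x))" for ls
  proof (rule linearI)
    have "emb (x + y) = emb x + emb y" "emb (r *\<^sub>R x) = complex_of_real r *s emb x" for x y r
      by (simp_all add: emb_def vec_eq_iff)
    then show "linear_factors ?M ls (emb (x + y)) = linear_factors ?M ls (emb x) + linear_factors ?M ls (emb y)"
      "linear_factors ?M ls (emb (r *\<^sub>R x)) = r *\<^sub>R linear_factors ?M ls (emb x)" for x y r
      by (simp_all add: linear_factors_linear scaleR_eq_smult)
  qed
  obtain ls where ls: "\<forall>l\<in>set ls. Re l < 0" "\<And>v. linear_factors ?M ls v = 0"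
    using hurwitz_annihilating_factors[OF assms] by blast
  have "\<exists>(b :: real^'m \<Rightarrow> real^'m \<Rightarrow> real) c. bilinear b \<and> (\<forall>x y. b x y = b y x) \<and> (\<forall>x. b x x \<ge> 0) \<and> c \<ge> 0 \<and>
         (\<forall>x. 2 * b x (A *v x) \<le> - (norm x)\<^sup>2 + c * (norm (linear_factors ?M ls (emb x)))\<^sup>2)"
    using ls(1)
  proof (induction ls)
    case Nil
    have "(norm (emb x))\<^sup>2 = (norm x)\<^sup>2" for x
      by (simp add: power2_norm_eq_inner inner_vec_def emb_def inner_complex_def)
    then show ?case
      \<comment> \<open>Without factors the error term is the squared norm of \<open>emb x\<close>,
        that of \<open>x\<close> itself; with \<open>c = 1\<close> it cancels the decay and the zero
        form suffices.\<close>
      by (intro exI[of _ "\<lambda>x y. 0"] exI[of _ 1])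
        (simp add: bilinear_def module_hom_zero)
  next
    case (Cons l ls)
    then obtain b :: "real^'m \<Rightarrow> real^'m \<Rightarrow> real" and c where b: "bilinear b" "\<And>x y. b x y = b y x" "\<And>x. b x x \<ge> 0" "c \<ge> 0"
        "\<And>x. 2 * b x (A *v x) \<le> - (norm x)\<^sup>2 + c * (norm (linear_factors ?M ls (emb x)))\<^sup>2"
      by auto
    define N where "N x = linear_factors ?M ls (emb x)" for x
    define a where "a = - Re l"
    have a: "a > 0" using Cons.prems by (simp add: a_def)
    \<comment> \<open>The weight for which the remaining decay \<open>k * a\<close> of the new term
      equals the old error coefficient \<open>c\<close>.\<close>
    define k where "k = c / a"
    have k: "k \<ge> 0" using a b(4) by (simp add: k_def)
    define b' where "b' x y = b x y + k * (N x \<bullet> N y)" for x y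
    note linN = linear_add[OF lin[of ls]] linear_cmul[OF lin[of ls]]
    have "bilinear b'"
      unfolding bilinear_def b'_def N_def
      by (auto intro!: linearI simp: bilinear_ladd[OF b(1)] bilinear_radd[OF b(1)]
          bilinear_lmul[OF b(1)] bilinear_rmul[OF b(1)] linN inner_add algebra_simps)
    moreover have "b' x y = b' y x" "b' x x \<ge> 0" for x y
      using b(2,3) k by (simp_all add: b'_def inner_commute)
    moreover have "2 * b' x (A *v x) \<le> - (norm x)\<^sup>2 + (k / a) * (norm (linear_factors ?M (l # ls) (emb x)))\<^sup>2" for x
    proof -
      define N' where "N' = linear_factors ?M (l # ls) (emb x)"
      have "N (A *v x) = N' + l *s N x"
        by (simp add: N_def N'_def emb_mult linear_factors_commute)
      then have "2 * (N x \<bullet> N (A *v x)) = - 2 * a * (norm (N x))\<^sup>2 + 2 * (N x \<bullet> N')"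
        by (simp add: inner_add inner_commute[of "N x"] inner_smult_complex_self a_def)
      \<comment> \<open>Young's inequality: half of the decay rate \<open>2 * a\<close> pays for the
        cross term.\<close>
      also have "2 * (N x \<bullet> N') \<le> a * (norm (N x))\<^sup>2 + (norm N')\<^sup>2 / a"
      proof -
        have "0 \<le> (norm (sqrt a *\<^sub>R N x - (1 / sqrt a) *\<^sub>R N'))\<^sup>2" by simp
        also have "\<dots> = a * (norm (N x))\<^sup>2 + (norm N')\<^sup>2 / a - 2 * (N x \<bullet> N')"
          using a by (simp add: power2_norm_eq_inner inner_diff inner_commute field_simps)
        finally show ?thesis by simp
      qed
      finally have "2 * (N x \<bullet> N (A *v x)) \<le> - a * (norm (N x))\<^sup>2 + (norm N')\<^sup>2 / a" by simp
      from mult_left_mono[OF this k]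
      have "2 * (k * (N x \<bullet> N (A *v x))) \<le> - c * (norm (N x))\<^sup>2 + (k / a) * (norm N')\<^sup>2"
        using a by (simp add: k_def field_simps)
      then show ?thesis
        using b(5)[of x] unfolding b'_def N'_def N_def[symmetric] by simp
    qed
    moreover have "k / a \<ge> 0" using k a by simp
    ultimately show ?case by blast
  qed
  then show ?thesis using ls(2) that by auto
qed

section \<open>Quadratic forms along absolutely continuous curves\<close>

text \<open>Increments of \<Phi> add up over adjacent intervals, so an estimate valid on short
  intervals extends to [0, T] by induction on the number of steps of length \<delta> / 2, which is
  safely below \<delta>.\<close>

lemma small_steps_bound:
  fixes G \<Phi> :: "real \<Rightarrow> real"
  assumes "\<delta> > 0"
    and step: "\<And>s t. 0 \<le> s \<Longrightarrow> s \<le> t \<Longrightarrow> t \<le> T \<Longrightarrow> t - s < \<delta> \<Longrightarrow> \<bar>G t - G s\<bar> \<le> \<Phi> t - \<Phi> s"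
    and "0 \<le> T"
  shows "\<bar>G T - G 0\<bar> \<le> \<Phi> T - \<Phi> 0"
proof -
  have *: "\<bar>G t - G 0\<bar> \<le> \<Phi> t - \<Phi> 0" if "0 \<le> t" "t \<le> T" "t \<le> real n * (\<delta> / 2)" for n t
    using that
  proof (induction n arbitrary: t)
    case 0
    then show ?case by simp
  next
    case (Suc n)
    define s where "s = max 0 (t - \<delta> / 2)"
    have "\<bar>G s - G 0\<bar> \<le> \<Phi> s - \<Phi> 0"
      using Suc.prems \<open>\<delta> > 0\<close> by (intro Suc.IH) (auto simp: s_def max_def algebra_simps)
    moreover have "\<bar>G t - G s\<bar> \<le> \<Phi> t - \<Phi> s"
      using Suc.prems \<open>\<delta> > 0\<close> by (intro step) (auto simp: s_def)
    ultimately show ?case by linarith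
  qed
  obtain n :: nat where "T / (\<delta> / 2) < n" using reals_Archimedean2 by blast
  then have "T \<le> real n * (\<delta> / 2)" using \<open>\<delta> > 0\<close> by (simp add: field_simps)
  with *[of T n] \<open>0 \<le> T\<close> show ?thesis by simp
qed

text \<open>With \<open>f\<close> only integrable, the increment over [s, t] is written exactly as
  the integral of b (x t + x s) (f r). Uniform continuity replaces x t + x s by 2 x r at a cost of
  \<epsilon> times the integral of the norm of \<open>f\<close>; these errors add up over short
  steps, and \<epsilon> is arbitrary.\<close>

lemma quadratic_form_along_integral:
  fixes b :: "'a::euclidean_space \<Rightarrow> 'a \<Rightarrow> real" and x f :: "real \<Rightarrow> 'a"
  assumes b: "bilinear b" and sym: "\<And>v w. b v w = b w v"
    and f: "f absolutely_integrable_on {0..T}"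
    and x: "\<And>t. 0 \<le> t \<Longrightarrow> t \<le> T \<Longrightarrow> (f has_integral (x t - x0)) {0..t}"
    and T: "0 \<le> T"
  shows "(\<lambda>s. 2 * b (x s) (f s)) absolutely_integrable_on {0..T}"
    and "integral {0..T} (\<lambda>s. 2 * b (x s) (f s)) = b (x T) (x T) - b x0 x0"
proof -
  from b have bb: "bounded_bilinear b" by (simp add: bilinear_conv_bounded_bilinear)
  interpret b: bounded_bilinear b by fact
  have fi: "f integrable_on {0..T}" using f by (rule set_lebesgue_integral_eq_integral)
  have x_eq: "x t = x0 + integral {0..t} f" if "0 \<le> t" "t \<le> T" for t
    using integral_unique[OF x[OF that]] by simp
  have "continuous_on {0..T} (\<lambda>t. x0 + integral {0..t} f)"
    by (intro continuous_intros indefinite_integral_continuous_1 fi)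
  then have contx: "continuous_on {0..T} x"
    by (rule continuous_on_eq) (simp add: x_eq)
  have abs_gen: "(\<lambda>s. b (g s) (f s)) absolutely_integrable_on {s..t}"
    if "continuous_on {0..T} g" "0 \<le> s" "t \<le> T" for g s t
  proof -
    have sub: "{s..t} \<subseteq> {0..T}" using that by auto
    have g: "continuous_on {s..t} g" using that(1) sub by (rule continuous_on_subset)
    show ?thesis
    proof (rule absolutely_integrable_bounded_measurable_product[OF b])
      show "g \<in> borel_measurable (lebesgue_on {s..t})"
        using g by (intro continuous_imp_measurable_on_sets_lebesgue) auto
      show "bounded (g ` {s..t})"
        using compact_continuous_image[OF g] by (auto intro: compact_imp_bounded)
      show "f absolutely_integrable_on {s..t}"
        using f sub by (rule absolutely_integrable_on_subinterval)
    qed auto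
  qed
  show "(\<lambda>s. 2 * b (x s) (f s)) absolutely_integrable_on {0..T}"
    using abs_gen[OF contx, of 0 T] by (auto intro: set_integrable_mult_right)
  define h where "h s = b (x s) (f s)" for s
  have hi: "h integrable_on {s..t}" if "0 \<le> s" "t \<le> T" for s t
    unfolding h_def using abs_gen[OF contx that] by (rule set_lebesgue_integral_eq_integral)
  obtain K where K: "K > 0" "\<And>v w. norm (b v w) \<le> norm v * norm w * K"
    using b.pos_bounded by blast
  \<comment> \<open>The chain rule says that \<open>G\<close> has no increment over [0, T]. The
    increments of \<open>F\<close> are the additive quantity controlling its error.\<close>
  define G where "G t = b (x t) (x t) - 2 * integral {0..t} h" for t
  define F where "F t = integral {0..t} (\<lambda>s. norm (f s))" for t
  have ni: "(\<lambda>s. norm (f s)) integrable_on {s..t}" if "0 \<le> s" "t \<le> T" for s t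
    using absolutely_integrable_on_subinterval[OF f, of s t] that
    by (auto simp: absolutely_integrable_on_def)
  have bound: "\<bar>G T - G 0\<bar> \<le> \<epsilon> * K * F T" if "\<epsilon> > 0" for \<epsilon>
  proof -
    have "uniformly_continuous_on {0..T} x"
      using contx by (intro compact_uniformly_continuous) auto
    then obtain \<delta> where \<delta>: "\<delta> > 0"
      "\<And>s t. s \<in> {0..T} \<Longrightarrow> t \<in> {0..T} \<Longrightarrow> dist s t < \<delta> \<Longrightarrow> dist (x s) (x t) < \<epsilon> / 2"
      unfolding uniformly_continuous_on_def using \<open>\<epsilon> > 0\<close> half_gt_zero by meson
    have "\<bar>G t - G s\<bar> \<le> \<epsilon> * K * F t - \<epsilon> * K * F s"
      if st: "0 \<le> s" "s \<le> t" "t \<le> T" "t - s < \<delta>" for s t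
    proof -
      have hst: "integral {0..t} h = integral {0..s} h + integral {s..t} h"
        using hi[of 0 t] st by (intro Henstock_Kurzweil_Integration.integral_combine[symmetric]) auto
      have fst: "integral {0..t} f = integral {0..s} f + integral {s..t} f"
        using st by (intro Henstock_Kurzweil_Integration.integral_combine[symmetric] integrable_on_subinterval[OF fi]) auto
      have Fst: "F t = F s + integral {s..t} (\<lambda>s. norm (f s))"
        unfolding F_def using ni[of 0 t] st by (intro Henstock_Kurzweil_Integration.integral_combine[symmetric]) auto
      have fst_i: "f integrable_on {s..t}"
        using st by (intro integrable_on_subinterval[OF fi]) auto
      let ?v = "x t + x s"
      \<comment> \<open>Difference of squares for a symmetric form: exact, with no quadratic
        remainder in x t - x s.\<close>
      have "b (x t) (x t) - b (x s) (x s) = b ?v (x t - x s)"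
        by (simp add: b.add_left b.diff_right sym[of "x s" "x t"])
      also have "x t - x s = integral {s..t} f"
        using st by (simp add: x_eq fst)
      also have "b ?v (integral {s..t} f) = integral {s..t} (\<lambda>r. b ?v (f r))"
        using integral_linear[OF fst_i b.bounded_linear_right[of ?v]] by (simp add: o_def)
      finally have "G t - G s = integral {s..t} (\<lambda>r. b ?v (f r)) - integral {s..t} (\<lambda>r. 2 * h r)"
        by (simp add: G_def hst)
      also have "\<dots> = integral {s..t} (\<lambda>r. b ?v (f r) - 2 * h r)"
        using integrable_linear[OF fst_i b.bounded_linear_right[of ?v]] hi[of s t] st
        by (intro integral_diff[symmetric]) (auto simp: o_def)
      also have "norm \<dots> \<le> integral {s..t} (\<lambda>r. \<epsilon> * K * norm (f r))"
      proof (rule integral_norm_bound_integral)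
        show "(\<lambda>r. b ?v (f r) - 2 * h r) integrable_on {s..t}"
          using integrable_linear[OF fst_i b.bounded_linear_right[of ?v]] hi[of s t] st
          by (intro integrable_diff) (auto simp: o_def)
        show "(\<lambda>r. \<epsilon> * K * norm (f r)) integrable_on {s..t}"
          using ni[of s t] st by (intro integrable_on_mult_right) auto
        fix r assume r: "r \<in> {s..t}"
        have "dist (x t) (x r) < \<epsilon> / 2" "dist (x s) (x r) < \<epsilon> / 2"
          using \<delta>(2)[of t r] \<delta>(2)[of s r] r st by (auto simp: dist_real_def)
        then have "norm (?v - 2 *\<^sub>R x r) \<le> \<epsilon>"
          using norm_triangle_ineq[of "x t - x r" "x s - x r"]
          by (simp add: dist_norm scaleR_2 algebra_simps)
        then have "norm (?v - 2 *\<^sub>R x r) * norm (f r) * K \<le> \<epsilon> * norm (f r) * K"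
          using K(1) by (intro mult_right_mono) auto
        moreover have "b ?v (f r) - 2 * h r = b (?v - 2 *\<^sub>R x r) (f r)"
          by (simp add: h_def b.diff_left b.scaleR_left)
        ultimately show "norm (b ?v (f r) - 2 * h r) \<le> \<epsilon> * K * norm (f r)"
          using K(2)[of "?v - 2 *\<^sub>R x r" "f r"] by (simp add: mult_ac)
      qed
      finally show ?thesis by (simp add: Fst algebra_simps)
    qed
    from small_steps_bound[where \<Phi> = "\<lambda>t. \<epsilon> * K * F t", OF \<delta>(1) this T]
    show ?thesis by (simp add: F_def)
  qed
  have "\<bar>G T - G 0\<bar> \<le> 0"
  proof (rule field_le_epsilon)
    fix e :: real assume "e > 0"
    have FT: "F T \<ge> 0" unfolding F_def by (intro integral_nonneg ni) auto
    \<comment> \<open>The \<open>+ 1\<close> covers the case F T = 0.\<close>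
    have "\<bar>G T - G 0\<bar> \<le> (e / (F T + 1) / K) * K * F T"
      using \<open>e > 0\<close> K FT by (intro bound) auto
    also have "\<dots> = e * (F T / (F T + 1))" using K by simp
    also have "\<dots> \<le> e * 1" using FT \<open>e > 0\<close> by (intro mult_left_mono) auto
    finally show "\<bar>G T - G 0\<bar> \<le> 0 + e" by simp
  qed
  then have "2 * integral {0..T} h = b (x T) (x T) - b x0 x0"
    using x_eq[of 0] T by (simp add: G_def)
  then show "integral {0..T} (\<lambda>s. 2 * b (x s) (f s)) = b (x T) (x T) - b x0 x0"
    by (simp add: h_def[abs_def])
qed

section \<open>Integration on the half-line\<close>

lemma integrable_lebesgue_on_iff:
  fixes f :: "'a::euclidean_space \<Rightarrow> 'b::euclidean_space"
  assumes "S \<in> sets lebesgue"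
  shows "integrable (lebesgue_on S) f \<longleftrightarrow> f absolutely_integrable_on S"
  using assms by (simp add: integrable_restrict_space set_integrable_def)

lemma nonneg_integrable_halfline:
  fixes f :: "real \<Rightarrow> real"
  assumes nonneg: "\<And>t. 0 \<le> t \<Longrightarrow> 0 \<le> f t"
    and f: "\<And>T. 0 \<le> T \<Longrightarrow> f integrable_on {0..T}"
    and bound: "\<And>T. 0 \<le> T \<Longrightarrow> integral {0..T} f \<le> c"
  shows "f integrable_on {0..}" "integral {0..} f \<le> c"
proof -
  define g where "g n t = (if t \<in> {0..real n} then f t else 0)" for n t
  have gi: "g n integrable_on {0..}" "integral {0..} (g n) = integral {0..real n} f" for n
  proof -
    have "(g n has_integral integral {0..real n} f) {0..}"
      unfolding g_def by (subst has_integral_restrict) (auto intro!: integrable_integral f)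
    then show "g n integrable_on {0..}" "integral {0..} (g n) = integral {0..real n} f"
      by (auto simp: integral_unique has_integral_integrable)
  qed
  have lim: "(\<lambda>n. g n t) \<longlonglongrightarrow> f t" if "t \<in> {0..}" for t
  proof -
    obtain n0 :: nat where "t \<le> n0" using real_arch_simple by blast
    then have "\<forall>n\<ge>n0. g n t = f t" using that by (auto simp: g_def)
    then show ?thesis by (intro tendsto_eventually) (auto simp: eventually_sequentially)
  qed
  have pos: "integral {0..real n} f \<ge> 0" for n
    using nonneg by (intro integral_nonneg f) auto
  have "f integrable_on {0..} \<and> (\<lambda>n. integral {0..} (g n)) \<longlonglongrightarrow> integral {0..} f"
  proof (rule monotone_convergence_increasing[OF gi(1) _ lim])
    show "g k t \<le> g (Suc k) t" if "t \<in> {0..}" for k t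
      using that nonneg by (auto simp: g_def)
    show "bounded (range (\<lambda>k. integral {0..} (g k)))"
      using bound pos by (auto simp: bounded_iff gi intro!: exI[of _ c])
  qed
  then have lim: "(\<lambda>n. integral {0..real n} f) \<longlonglongrightarrow> integral {0..} f"
    and "f integrable_on {0..}" by (simp_all add: gi)
  then show "f integrable_on {0..}" by simp
  show "integral {0..} f \<le> c"
    by (rule LIMSEQ_le_const2[OF lim]) (auto intro!: bound)
qed

lemma integral_halfline_limit:
  fixes f :: "real \<Rightarrow> real"
  assumes f: "f absolutely_integrable_on {0..}"
  shows "((\<lambda>T. integral {0..T} f) \<longlongrightarrow> integral {0..} f) at_top"
proof (rule tendsto_at_topI_sequentially)
  fix X :: "nat \<Rightarrow> real" assume X: "filterlim X at_top sequentially"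
  define g where "g n t = (if t \<in> {0..X n} then f t else 0)" for n t
  have f': "f integrable_on {0..X n}" for n
    using absolutely_integrable_on_subinterval[OF f, of 0 "X n"]
    by (auto intro: set_lebesgue_integral_eq_integral)
  have gi: "g n integrable_on {0..}" "integral {0..} (g n) = integral {0..X n} f" for n
  proof -
    have "(g n has_integral integral {0..X n} f) {0..}"
      unfolding g_def by (subst has_integral_restrict) (auto intro!: integrable_integral f')
    then show "g n integrable_on {0..}" "integral {0..} (g n) = integral {0..X n} f"
      by (auto simp: integral_unique has_integral_integrable)
  qed
  have "(\<lambda>n. integral {0..} (g n)) \<longlonglongrightarrow> integral {0..} f"
  proof (rule dominated_convergence(2)[OF gi(1)])
    show "(\<lambda>t. norm (f t)) integrable_on {0..}"
      using f by (simp add: absolutely_integrable_on_def)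
    show "norm (g n t) \<le> norm (f t)" for n t by (simp add: g_def)
    fix t :: real assume "t \<in> {0..}"
    have "eventually (\<lambda>n. t \<le> X n) sequentially"
      using X by (simp add: filterlim_at_top)
    then have "eventually (\<lambda>n. g n t = f t) sequentially"
      by eventually_elim (use \<open>t \<in> {0..}\<close> in \<open>simp add: g_def\<close>)
    then show "(\<lambda>n. g n t) \<longlonglongrightarrow> f t" by (rule tendsto_eventually)
  qed
  then show "(\<lambda>n. integral {0..X n} f) \<longlonglongrightarrow> integral {0..} f" by (simp add: gi)
qed

lemma integral_concat:
  fixes f g :: "real \<Rightarrow> real"
  assumes T: "0 \<le> T" and f: "f absolutely_integrable_on {0..T}" and g: "g absolutely_integrable_on {0..}"
  defines "h \<equiv> \<lambda>t. if t \<le> T then f t else g (t - T)"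
  shows "h absolutely_integrable_on {0..}" "integral {0..} h = integral {0..T} f + integral {0..} g"
proof -
  \<comment> \<open>Extension by zero turns the shift by \<open>T\<close> into an affine
    substitution on the whole line.\<close>
  define g0 where "g0 t = (if t \<in> {0..} then g t else 0)" for t
  have g0: "integrable lebesgue g0"
    using g unfolding set_integrable_def indicator_scaleR_eq_if g0_def .
  define g1 where "g1 t = g0 (- T + 1 * t)" for t
  have g1: "integrable lebesgue g1"
    unfolding g1_def by (rule lebesgue_integrable_real_affine[OF g0]) simp
  have g1_eq: "g1 = (\<lambda>t. if t \<in> {T..} then g (t - T) else 0)"
    by (auto simp: g1_def g0_def)
  have ga: "(\<lambda>t. g (t - T)) absolutely_integrable_on {T..}"
    using g1 unfolding set_integrable_def g1_eq
    by (subst indicator_scaleR_eq_if)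
  have "integral {T..} (\<lambda>t. g (t - T)) = integral UNIV g1"
    by (simp only: g1_eq integral_restrict_UNIV)
  also have "\<dots> = integral\<^sup>L lebesgue g1" by (rule integral_lebesgue[OF g1])
  also have "\<dots> = integral\<^sup>L lebesgue g0"
    using lebesgue_integral_real_affine[of 1 g0 "- T"] by (simp add: g1_def[abs_def])
  also have "\<dots> = integral UNIV g0" by (rule integral_lebesgue[OF g0, symmetric])
  also have "\<dots> = integral {0..} g" by (simp only: g0_def[abs_def] integral_restrict_UNIV)
  finally have gint: "integral {T..} (\<lambda>t. g (t - T)) = integral {0..} g" .
  have h1: "h absolutely_integrable_on {0..T}"
    by (rule absolutely_integrable_spike[OF f negligible_empty]) (simp add: h_def)
  \<comment> \<open>At \<open>T\<close> itself \<open>h\<close> takes the value of \<open>f\<close>,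
    not of \<open>g\<close>; a single point is negligible.\<close>
  have h2: "h absolutely_integrable_on {T..}"
    by (rule absolutely_integrable_spike[OF ga negligible_sing[of T]]) (auto simp: h_def)
  have U: "{0..} = {0..T} \<union> {T..}" using T by auto
  show "h absolutely_integrable_on {0..}"
    unfolding U by (rule absolutely_integrable_Un[OF h1 h2])
  have "{0..T} \<inter> {T..} = {T}" using T by auto
  then have "integral {0..} h = integral {0..T} h + integral {T..} h"
    unfolding U using h1 h2 by (intro integral_Un) (auto intro: set_lebesgue_integral_eq_integral)
  also have "integral {0..T} h = integral {0..T} f"
    by (rule integral_cong) (simp add: h_def)
  also have "integral {T..} h = integral {T..} (\<lambda>t. g (t - T))"
    by (rule integral_spike[OF negligible_sing[of T]]) (auto simp: h_def)
  finally show "integral {0..} h = integral {0..T} f + integral {0..} g" by (simp add: gint)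
qed

section \<open>The space of square-integrable signals\<close>

lemma L2_iff:
  "u \<in> L2 \<longleftrightarrow> u \<in> borel_measurable (lebesgue_on {0..}) \<and> (\<lambda>t. (norm (u t))\<^sup>2) integrable_on {0..}"
proof -
  have "integrable (lebesgue_on {0..}) (\<lambda>t. (norm (u t))\<^sup>2) \<longleftrightarrow> (\<lambda>t. (norm (u t))\<^sup>2) integrable_on {0..}"
    by (simp add: integrable_lebesgue_on_iff absolutely_integrable_on_iff_nonneg)
  then show ?thesis by (simp add: L2_def)
qed

lemma L2_measurable: "u \<in> L2 \<Longrightarrow> u \<in> borel_measurable (lebesgue_on {0..})"
  and L2_integrable: "u \<in> L2 \<Longrightarrow> (\<lambda>t. (norm (u t))\<^sup>2) integrable_on {0..}"
  by (simp_all add: L2_iff)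

lemma L2_bilinear:
  fixes b :: "real^'k \<Rightarrow> real^'l \<Rightarrow> real"
  assumes b: "bilinear b" and u: "u \<in> L2" and v: "v \<in> L2"
  shows "(\<lambda>t. b (u t) (v t)) absolutely_integrable_on {0..}"
proof -
  obtain K where K: "K > 0" "\<And>x y. norm (b x y) \<le> K * norm x * norm y"
    using bilinear_bounded_pos[OF b] by blast
  show ?thesis
  proof (rule measurable_bounded_by_integrable_imp_absolutely_integrable)
    show "(\<lambda>t. b (u t) (v t)) \<in> borel_measurable (lebesgue_on {0..})"
      using u v by (auto intro: borel_measurable_bilinear[OF b] simp: L2_iff)
    show "(\<lambda>t. K * ((norm (u t))\<^sup>2 + (norm (v t))\<^sup>2)) integrable_on {0..}"
      using u v by (intro integrable_on_mult_right integrable_add) (auto simp: L2_iff)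
    fix t :: real
    have "norm (u t) * norm (v t) \<le> (norm (u t))\<^sup>2 + (norm (v t))\<^sup>2"
      using sum_squares_bound[of "norm (u t)" "norm (v t)"]
        mult_nonneg_nonneg[of "norm (u t)" "norm (v t)", OF norm_ge_zero norm_ge_zero] by linarith
    then have "K * (norm (u t) * norm (v t)) \<le> K * ((norm (u t))\<^sup>2 + (norm (v t))\<^sup>2)"
      using K(1) by (intro mult_left_mono) auto
    then show "norm (b (u t) (v t)) \<le> K * ((norm (u t))\<^sup>2 + (norm (v t))\<^sup>2)"
      using K(2)[of "u t" "v t"] by (simp add: mult.assoc)
  qed auto
qed

lemma bilinear_inner: "bilinear ((\<bullet>) :: 'a::euclidean_space \<Rightarrow> 'a \<Rightarrow> real)"
  by (simp add: bilinear_conv_bounded_bilinear bounded_bilinear_inner)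

lemmas L2_inner = L2_bilinear[OF bilinear_inner]

lemma L2_linear:
  fixes f :: "real^'k \<Rightarrow> real^'l"
  assumes f: "linear f" and u: "u \<in> L2"
  shows "(\<lambda>t. f (u t)) \<in> L2"
proof -
  have "bilinear (\<lambda>x y. f x \<bullet> f y)"
    using f by (auto simp: bilinear_def linear_add linear_cmul inner_add intro!: linearI)
  from L2_bilinear[OF this u u] have "(\<lambda>t. (norm (f (u t)))\<^sup>2) integrable_on {0..}"
    by (simp add: power2_norm_eq_inner set_lebesgue_integral_eq_integral(1))
  moreover have "f \<in> borel_measurable borel"
    using f by (intro borel_measurable_continuous_onI linear_continuous_on)
      (simp add: linear_conv_bounded_linear)
  then have "(\<lambda>t. f (u t)) \<in> borel_measurable (lebesgue_on {0..})"
    using L2_measurable[OF u] by measurable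
  ultimately show ?thesis by (simp add: L2_iff)
qed

lemmas L2_matrix_vector_mult = L2_linear[OF matrix_vector_mul_linear]

lemma L2_scaleR: "u \<in> L2 \<Longrightarrow> (\<lambda>t. c *\<^sub>R u t) \<in> L2"
  by (rule L2_linear) (auto intro: linear_scaleR)

lemma L2_add:
  assumes "u \<in> L2" "v \<in> L2"
  shows "(\<lambda>t. u t + v t) \<in> L2"
proof -
  have "(norm (u t + v t))\<^sup>2 = (norm (u t))\<^sup>2 + 2 * (u t \<bullet> v t) + (norm (v t))\<^sup>2" for t
    by (simp add: power2_norm_eq_inner inner_add inner_commute)
  moreover have "(\<lambda>t. (norm (u t))\<^sup>2 + 2 * (u t \<bullet> v t) + (norm (v t))\<^sup>2) integrable_on {0..}"
    using assms L2_inner[OF assms]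
    by (intro integrable_add integrable_on_mult_right) (auto simp: L2_iff set_lebesgue_integral_eq_integral)
  moreover have "(\<lambda>t. u t + v t) \<in> borel_measurable (lebesgue_on {0..})"
    using assms by (auto simp: L2_iff)
  ultimately show ?thesis by (simp add: L2_iff)
qed

lemma L2_diff:
  assumes "u \<in> L2" "v \<in> L2"
  shows "(\<lambda>t. u t - v t) \<in> L2"
  using L2_add[OF assms(1) L2_scaleR[OF assms(2), of "-1"]] by simp

lemma L2_imp_absolutely_integrable:
  assumes u: "u \<in> L2" and "0 \<le> T"
  shows "u absolutely_integrable_on {0..T}"
proof (rule measurable_bounded_by_integrable_imp_absolutely_integrable)
  show "u \<in> borel_measurable (lebesgue_on {0..T})"
    using L2_measurable[OF u] by (rule measurable_restrict_mono) auto
  show "(\<lambda>t. 1 + (norm (u t))\<^sup>2) integrable_on {0..T}"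
    using L2_integrable[OF u]
    by (intro integrable_add) (auto intro: integrable_on_superset integrable_on_subinterval)
  show "norm (u t) \<le> 1 + (norm (u t))\<^sup>2" for t
    using sum_squares_bound[of 1 "norm (u t)"] norm_ge_zero[of "u t"] unfolding mult_1_right one_power2 by linarith
qed auto

lemma L2_concat:
  assumes T: "0 \<le> T" and u: "u \<in> L2" and v: "v \<in> L2"
  shows "(\<lambda>t. if t \<le> T then u t else v (t - T)) \<in> L2"
proof -
  define w where "w t = (if t \<le> T then u t else v (t - T))" for t
  define u0 where "u0 t = (if t \<in> {0..} then u t else 0)" for t
  define v0 where "v0 t = (if t \<in> {0..} then v t else 0)" for t
  have u0: "u0 \<in> borel_measurable lebesgue"
    unfolding u0_def by (rule borel_measurable_if_I[OF L2_measurable[OF u]]) simp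
  have v0: "v0 \<in> borel_measurable lebesgue"
    unfolding v0_def by (rule borel_measurable_if_I[OF L2_measurable[OF v]]) simp
  have "(\<lambda>t. v0 (- T + 1 *\<^sub>R t)) \<in> borel_measurable lebesgue"
    by (rule borel_measurable_affine[OF v0]) simp
  then have "(\<lambda>t. if t \<le> T then u0 t else v0 (- T + 1 *\<^sub>R t)) \<in> borel_measurable lebesgue"
    using u0 by (intro measurable_If) auto
  also have "(\<lambda>t. if t \<le> T then u0 t else v0 (- T + 1 *\<^sub>R t)) = (\<lambda>t. if t \<in> {0..} then w t else 0)"
    using T by (auto simp: w_def u0_def v0_def)
  finally have "w \<in> borel_measurable (lebesgue_on {0..})"
    by (rule borel_measurable_if_D)
  moreover have "(\<lambda>t. (norm (w t))\<^sup>2) integrable_on {0..}"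
  proof -
    have u2: "(\<lambda>t. (norm (u t))\<^sup>2) absolutely_integrable_on {0..}"
      and v2: "(\<lambda>t. (norm (v t))\<^sup>2) absolutely_integrable_on {0..}"
      using u v by (auto simp: L2_iff absolutely_integrable_on_iff_nonneg)
    from u2 have "(\<lambda>t. (norm (u t))\<^sup>2) absolutely_integrable_on {0..T}"
      by (rule absolutely_integrable_on_subinterval) auto
    from integral_concat(1)[OF T this v2]
    have "(\<lambda>t. if t \<le> T then (norm (u t))\<^sup>2 else (norm (v (t - T)))\<^sup>2) integrable_on {0..}"
      by (rule set_lebesgue_integral_eq_integral)
    then show ?thesis by (simp add: w_def if_distrib[of norm] if_distrib[of "\<lambda>x. x\<^sup>2"])
  qed
  ultimately show ?thesis by (simp add: L2_iff w_def[abs_def])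
qed

section \<open>Trajectories\<close>

text \<open>The induction step of Picard's estimate, shared by uniqueness and existence: each
  integration gains one power of \<open>K * t\<close> and one factor of the factorial.\<close>

lemma integral_power_over_fact_bound:
  fixes f :: "real \<Rightarrow> 'a::euclidean_space" and L :: "'a \<Rightarrow> 'b::euclidean_space"
  assumes L: "\<And>v. norm (L v) \<le> norm v * K" "K \<ge> 0"
    and int: "(\<lambda>s. L (f s)) integrable_on {0..t}" and t: "0 \<le> t"
    and f: "\<And>s. 0 \<le> s \<Longrightarrow> s \<le> t \<Longrightarrow> norm (f s) \<le> M * (K * s) ^ n / fact n"
  shows "norm (integral {0..t} (\<lambda>s. L (f s))) \<le> M * (K * t) ^ Suc n / fact (Suc n)"
proof -
  have deriv: "((\<lambda>s. M * (K * s) ^ Suc n / fact (Suc n)) has_vector_derivative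
          M * (K * s) ^ n / fact n * K) (at s within {0..t})" for s
  proof -
    have "((\<lambda>s. M * (K * s) ^ Suc n / fact (Suc n)) has_real_derivative
          M * (real (Suc n) * (K * s) ^ n * K) / fact (Suc n)) (at s within {0..t})"
      by (auto intro!: derivative_eq_intros simp del: power_Suc fact_Suc)
    also have "M * (real (Suc n) * (K * s) ^ n * K) / fact (Suc n) = M * (K * s) ^ n / fact n * K"
      by (simp add: fact_Suc del: of_nat_Suc)
    finally show ?thesis
      by (simp only: has_real_derivative_iff_has_vector_derivative)
  qed
  have "((\<lambda>s. M * (K * s) ^ n / fact n * K) has_integral
          M * (K * t) ^ Suc n / fact (Suc n) - M * (K * 0) ^ Suc n / fact (Suc n)) {0..t}"
    using deriv by (intro fundamental_theorem_of_calculus t)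
  then have I: "((\<lambda>s. M * (K * s) ^ n / fact n * K) has_integral M * (K * t) ^ Suc n / fact (Suc n)) {0..t}"
    by simp
  have "norm (integral {0..t} (\<lambda>s. L (f s))) \<le> integral {0..t} (\<lambda>s. M * (K * s) ^ n / fact n * K)"
  proof (rule integral_norm_bound_integral[OF int])
    show "(\<lambda>s. M * (K * s) ^ n / fact n * K) integrable_on {0..t}"
      using I by (rule has_integral_integrable)
    fix s assume "s \<in> {0..t}"
    then have "norm (f s) * K \<le> M * (K * s) ^ n / fact n * K"
      using f L(2) by (intro mult_right_mono) auto
    with L(1)[of "f s"] show "norm (L (f s)) \<le> M * (K * s) ^ n / fact n * K" by linarith
  qed
  with integral_unique[OF I] show ?thesis by simp
qed

text \<open>A solution of the homogeneous equation is reproduced by the integral operator, hence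
  bounded by the Picard estimate for every n, and that estimate tends to 0.\<close>

lemma volterra_unique:
  fixes e :: "real \<Rightarrow> 'a::euclidean_space"
  assumes L: "linear L" and e: "\<And>t. 0 \<le> t \<Longrightarrow> ((\<lambda>s. L (e s)) has_integral e t) {0..t}"
    and "0 \<le> t"
  shows "e t = 0"
proof -
  obtain K where K: "K \<ge> 0" "\<And>v. norm (L v) \<le> norm v * K"
    using L by (metis linear_conv_bounded_linear bounded_linear.nonneg_bounded)
  have "continuous_on {0..t} (\<lambda>s. integral {0..s} (\<lambda>r. L (e r)))"
    using e[OF \<open>0 \<le> t\<close>] by (intro indefinite_integral_continuous_1) (rule has_integral_integrable)
  then have cont: "continuous_on {0..t} e"
    by (rule continuous_on_eq) (use e in \<open>auto intro: integral_unique\<close>)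
  then have "bounded (e ` {0..t})"
    by (intro compact_imp_bounded compact_continuous_image) auto
  then obtain M where M: "\<forall>y\<in>e ` {0..t}. norm y \<le> M"
    unfolding bounded_iff by blast
  have bound: "norm (e s) \<le> M * (K * s) ^ n / fact n" if "0 \<le> s" "s \<le> t" for s n
    using that
  proof (induction n arbitrary: s)
    case 0
    then show ?case using M by simp
  next
    case (Suc n)
    have "norm (integral {0..s} (\<lambda>r. L (e r))) \<le> M * (K * s) ^ Suc n / fact (Suc n)"
      using K Suc.prems Suc.IH has_integral_integrable[OF e[of s]]
      by (intro integral_power_over_fact_bound) auto
    then show ?case using integral_unique[OF e[of s]] Suc.prems by simp
  qed
  have "(\<lambda>n. M * ((K * t) ^ n /\<^sub>R fact n)) \<longlonglongrightarrow> M * 0"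
    using summable_exp_generic[of "K * t"] by (intro tendsto_intros summable_LIMSEQ_zero)
  then have lim: "(\<lambda>n. M * (K * t) ^ n / fact n) \<longlonglongrightarrow> 0"
    by (simp add: field_simps)
  have "norm (e t) \<le> 0"
    by (rule LIMSEQ_le_const[OF lim]) (use bound[of t] \<open>0 \<le> t\<close> in auto)
  then show ?thesis by simp
qed

text \<open>Picard iteration: the \<open>n\<close>-th correction is bounded by \<open>M (K t)\<^sup>n / n!\<close>, so that
  the series of the corrections converges uniformly on bounded intervals.\<close>

lemma volterra_solution:
  fixes \<phi> :: "real \<Rightarrow> 'a::euclidean_space"
  assumes L: "linear L" and \<phi>: "\<And>T. continuous_on {0..T} \<phi>"
  obtains x where "\<And>t. 0 \<le> t \<Longrightarrow> ((\<lambda>s. L (x s)) has_integral (x t - \<phi> t)) {0..t}"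
proof -
  obtain K where K: "K \<ge> 0" "\<And>v. norm (L v) \<le> norm v * K"
    using L by (metis linear_conv_bounded_linear bounded_linear.nonneg_bounded)
  interpret L: bounded_linear L using L by (simp add: linear_conv_bounded_linear)
  define p where "p = rec_nat \<phi> (\<lambda>_ f t. integral {0..t} (\<lambda>s. L (f s)))"
  have p_simps: "p 0 = \<phi>" "\<And>n. p (Suc n) = (\<lambda>t. integral {0..t} (\<lambda>s. L (p n s)))"
    by (simp_all add: p_def)
  have p_cont: "continuous_on {0..T} (p n)" for n T
  proof (induction n)
    case 0
    show ?case using \<phi> by (simp add: p_simps)
  next
    case (Suc n)
    show ?case unfolding p_simps
      by (intro indefinite_integral_continuous_1 integrable_continuous_real L.continuous_on Suc)
  qed
  then have Lp_int: "(\<lambda>s. L (p n s)) integrable_on {0..t}" for n t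
    by (intro integrable_continuous_real L.continuous_on)
  define x where "x t = (\<Sum>n. p n t)" for t
  have "((\<lambda>s. L (x s)) has_integral (x T - \<phi> T)) {0..T}" if T: "0 \<le> T" for T
  proof -
    have "bounded (\<phi> ` {0..T})"
      using \<phi> by (intro compact_imp_bounded compact_continuous_image) auto
    then obtain M where M: "\<forall>y\<in>\<phi> ` {0..T}. norm y \<le> M"
      unfolding bounded_iff by blast
    then have "norm (\<phi> 0) \<le> M" using T by simp
    then have M0: "M \<ge> 0" using norm_ge_zero[of "\<phi> 0"] by linarith
    have bound: "norm (p n s) \<le> M * (K * s) ^ n / fact n" if "0 \<le> s" "s \<le> T" for s n
      using that
    proof (induction n arbitrary: s)
      case 0
      then show ?case using M by (simp add: p_simps)
    next
      case (Suc n)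
      then show ?case
        unfolding p_simps by (intro integral_power_over_fact_bound K Lp_int) auto
    qed
    have unif: "uniform_limit {0..T} (\<lambda>n s. \<Sum>i<n. p i s) x sequentially"
      unfolding x_def
    proof (rule Weierstrass_m_test)
      fix n s assume s: "s \<in> {0..T}"
      have "norm (p n s) \<le> M * (K * s) ^ n / fact n" using bound s by auto
      also have "\<dots> \<le> M * (K * T) ^ n / fact n"
        using s K M0 by (intro divide_right_mono mult_left_mono power_mono) auto
      finally show "norm (p n s) \<le> M * ((K * T) ^ n /\<^sub>R fact n)" by (simp add: field_simps)
    next
      show "summable (\<lambda>n. M * ((K * T) ^ n /\<^sub>R fact n))"
        by (intro summable_mult summable_exp_generic)
    qed
    have unifL: "uniform_limit {0..T} (\<lambda>n s. L (\<Sum>i<n. p i s)) (\<lambda>s. L (x s)) sequentially"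
      by (rule L.uniform_limit[OF unif])
    obtain I J where I: "\<And>n. ((\<lambda>s. L (\<Sum>i<n. p i s)) has_integral I n) {0..T}"
      and J: "((\<lambda>s. L (x s)) has_integral J) {0..T}" and IJ: "I \<longlonglongrightarrow> J"
    proof (rule uniform_limit_integral[OF unifL])
      show "continuous_on {0..T} (\<lambda>s. L (\<Sum>i<n. p i s))" for n
        by (intro L.continuous_on continuous_on_sum p_cont)
    qed auto
    \<comment> \<open>Integration shifts the series by one index, so the partial sum reappears with
      one more term but without the initial term \<phi>.\<close>
    have "I n = (\<Sum>i<Suc n. p i T) - \<phi> T" for n
    proof -
      have "I n = integral {0..T} (\<lambda>s. \<Sum>i<n. L (p i s))"
        using integral_unique[OF I[of n]] by (simp add: L.sum)
      also have "\<dots> = (\<Sum>i<n. p (Suc i) T)"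
        by (simp add: integral_sum Lp_int p_simps)
      also have "\<dots> = (\<Sum>i<Suc n. p i T) - \<phi> T"
        by (simp add: sum.lessThan_Suc_shift p_simps(1) del: sum.lessThan_Suc)
      finally show ?thesis .
    qed
    moreover have "(\<lambda>n. (\<Sum>i<Suc n. p i T) - \<phi> T) \<longlonglongrightarrow> x T - \<phi> T"
      using tendsto_uniform_limitI[OF unif, of T] T
      by (intro tendsto_diff tendsto_const LIMSEQ_Suc) auto
    ultimately have "I \<longlonglongrightarrow> x T - \<phi> T" by presburger
    with IJ have "J = x T - \<phi> T" by (rule LIMSEQ_unique)
    with J show ?thesis by simp
  qed
  with that show ?thesis by blast
qed

section \<open>Trajectories of the control system\<close>

text \<open>The integral of \<open>B *v u\<close> is continuous even if \<open>u\<close> is not, so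
  the input is absorbed into a continuous forcing term \<phi> and an equation in \<open>A\<close>
  alone remains.\<close>

lemma lti_trajectory_exists:
  assumes u: "u \<in> L2"
  obtains x where "lti_trajectory A B x0 u x"
proof -
  have Bu: "(\<lambda>s. B *v u s) integrable_on {0..T}" for T
  proof (cases "0 \<le> T")
    case True
    show ?thesis
      using L2_imp_absolutely_integrable[OF L2_matrix_vector_mult[OF u] True]
      by (rule set_lebesgue_integral_eq_integral)
  qed auto
  define \<phi> where "\<phi> t = x0 + integral {0..t} (\<lambda>s. B *v u s)" for t
  have "continuous_on {0..T} \<phi>" for T
    unfolding \<phi>_def by (intro continuous_intros indefinite_integral_continuous_1 Bu)
  then obtain x where x: "\<And>t. 0 \<le> t \<Longrightarrow> ((\<lambda>s. A *v x s) has_integral (x t - \<phi> t)) {0..t}"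
    using volterra_solution[of "(*v) A" \<phi>] matrix_vector_mul_linear by blast
  have "lti_trajectory A B x0 u x"
    unfolding lti_trajectory_def
  proof (intro allI impI)
    fix t :: real assume "0 \<le> t"
    from has_integral_add[OF x[OF this] integrable_integral[OF Bu[of t]]]
    show "((\<lambda>s. A *v x s + B *v u s) has_integral x t - x0) {0..t}" by (simp add: \<phi>_def)
  qed
  with that show ?thesis .
qed

lemma lti_trajectory_add:
  assumes "lti_trajectory A B x0 u x" "lti_trajectory A B y0 v y"
  shows "lti_trajectory A B (x0 + y0) (\<lambda>t. u t + v t) (\<lambda>t. x t + y t)"
  unfolding lti_trajectory_def
proof (intro allI impI)
  fix t :: real assume "0 \<le> t"
  then have "((\<lambda>s. (A *v x s + B *v u s) + (A *v y s + B *v v s)) has_integral (x t - x0) + (y t - y0)) {0..t}"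
    using assms by (intro has_integral_add) (auto simp: lti_trajectory_def)
  then show "((\<lambda>s. A *v (x s + y s) + B *v (u s + v s)) has_integral x t + y t - (x0 + y0)) {0..t}"
    by (simp add: matrix_vector_right_distrib algebra_simps)
qed

lemma lti_trajectory_scaleR:
  assumes "lti_trajectory A B x0 u x"
  shows "lti_trajectory A B (c *\<^sub>R x0) (\<lambda>t. c *\<^sub>R u t) (\<lambda>t. c *\<^sub>R x t)"
  unfolding lti_trajectory_def
proof (intro allI impI)
  fix t :: real assume "0 \<le> t"
  then have "((\<lambda>s. c *\<^sub>R (A *v x s + B *v u s)) has_integral c *\<^sub>R (x t - x0)) {0..t}"
    using assms by (intro has_integral_cmul) (auto simp: lti_trajectory_def)
  then show "((\<lambda>s. A *v (c *\<^sub>R x s) + B *v (c *\<^sub>R u s)) has_integral c *\<^sub>R x t - c *\<^sub>R x0) {0..t}"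
    by (simp add: matrix_vector_mult_scaleR scaleR_add_right scaleR_diff_right)
qed

lemma lti_trajectory_diff:
  assumes "lti_trajectory A B x0 u x" "lti_trajectory A B y0 v y"
  shows "lti_trajectory A B (x0 - y0) (\<lambda>t. u t - v t) (\<lambda>t. x t - y t)"
  using lti_trajectory_add[OF assms(1) lti_trajectory_scaleR[OF assms(2), of "-1"]] by simp

lemma lti_trajectory_unique:
  assumes x: "lti_trajectory A B x0 u x" and y: "lti_trajectory A B x0 u y" and t: "0 \<le> t"
  shows "x t = y t"
proof -
  have "((\<lambda>s. A *v (x s - y s)) has_integral x t - y t) {0..t}" if "0 \<le> t" for t
    using lti_trajectory_diff[OF x y] that by (simp add: lti_trajectory_def)
  from volterra_unique[OF matrix_vector_mul_linear this t] show ?thesis by simp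
qed

lemma lti_state_trajectory:
  assumes "u \<in> L2"
  shows "lti_trajectory A B 0 u (lti_state A B u)"
proof -
  obtain x where "lti_trajectory A B 0 u x"
    using lti_trajectory_exists[OF assms] .
  then show ?thesis unfolding lti_state_def by (rule someI[of "lti_trajectory A B 0 u"])
qed

lemma lti_trajectory_initial:
  assumes "lti_trajectory A B x0 u x"
  shows "x 0 = x0"
proof -
  have "((\<lambda>s. A *v x s + B *v u s) has_integral x 0 - x0) {0..0}"
    using assms[unfolded lti_trajectory_def] by blast
  from integral_unique[OF this] show ?thesis by simp
qed

lemma lti_trajectory_continuous:
  assumes "lti_trajectory A B x0 u x"
  shows "continuous_on {0..} x"
proof -
  have *: "continuous_on {0..T} x" if "0 \<le> T" for T
  proof -
    let ?f = "\<lambda>s. A *v x s + B *v u s"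
    have "?f integrable_on {0..T}"
      using assms that by (auto simp: lti_trajectory_def)
    then have "continuous_on {0..T} (\<lambda>t. x0 + integral {0..t} ?f)"
      by (intro continuous_intros indefinite_integral_continuous_1)
    then show ?thesis
    proof (rule continuous_on_eq)
      fix t assume "t \<in> {0..T}"
      then have "integral {0..t} ?f = x t - x0"
        using assms by (intro integral_unique) (auto simp: lti_trajectory_def)
      then show "x0 + integral {0..t} ?f = x t" by simp
    qed
  qed
  have "continuous (at t within {0..}) x" if "t \<in> {0..}" for t
  proof -
    have "continuous (at t within {0..t + 1}) x"
      using *[of "t + 1"] that by (auto simp: continuous_on_eq_continuous_within)
    moreover have "at t within {0..} = at t within {0..t + 1}"
      by (rule at_within_nhd[of _ "{..<t + 1}"]) auto
    ultimately show ?thesis by simp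
  qed
  then show ?thesis by (auto simp: continuous_on_eq_continuous_within)
qed

lemma lti_trajectory_measurable:
  "lti_trajectory A B x0 u x \<Longrightarrow> x \<in> borel_measurable (lebesgue_on {0..})"
  by (intro continuous_imp_measurable_on_sets_lebesgue lti_trajectory_continuous) auto

lemma lti_trajectory_absolutely_integrable:
  assumes x: "lti_trajectory A B x0 u x" and u: "u \<in> L2" and T: "0 \<le> T"
  shows "(\<lambda>s. A *v x s + B *v u s) absolutely_integrable_on {0..T}"
proof (rule set_integral_add(1))
  have "continuous_on {0..T} (\<lambda>s. A *v x s)"
    by (intro matrix_vector_mult_linear_continuous_on continuous_on_compose2[OF matrix_vector_mult_linear_continuous_on]
      continuous_on_subset[OF lti_trajectory_continuous[OF x]]) auto
  then show "(\<lambda>s. A *v x s) absolutely_integrable_on {0..T}"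
    by (rule absolutely_integrable_continuous_real)
  show "(\<lambda>s. B *v u s) absolutely_integrable_on {0..T}"
    by (rule L2_imp_absolutely_integrable[OF L2_matrix_vector_mult[OF u] T])
qed

lemma lti_trajectory_quadratic_form:
  fixes b :: "real^'m \<Rightarrow> real^'m \<Rightarrow> real"
  assumes b: "bilinear b" "\<And>v w. b v w = b w v"
    and x: "lti_trajectory A B x0 u x" and u: "u \<in> L2" and T: "0 \<le> T"
  shows "(\<lambda>s. 2 * b (x s) (A *v x s + B *v u s)) absolutely_integrable_on {0..T}"
    and "integral {0..T} (\<lambda>s. 2 * b (x s) (A *v x s + B *v u s)) = b (x T) (x T) - b x0 x0"
proof -
  have "((\<lambda>s. A *v x s + B *v u s) has_integral x t - x0) {0..t}" if "0 \<le> t" "t \<le> T" for t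
    using x that by (simp add: lti_trajectory_def)
  note * = quadratic_form_along_integral[OF b lti_trajectory_absolutely_integrable[OF x u T] this T]
  show "(\<lambda>s. 2 * b (x s) (A *v x s + B *v u s)) absolutely_integrable_on {0..T}"
    by (rule *(1))
  show "integral {0..T} (\<lambda>s. 2 * b (x s) (A *v x s + B *v u s)) = b (x T) (x T) - b x0 x0"
    by (rule *(2))
qed

text \<open>Along a trajectory the Lyapunov form has derivative at most -|x|^2 / 2 + d |u|^2, and
  integration gives the bound. One constant for all trajectories is essential: it later makes the
  optimal cost at most quadratic in the initial state.\<close>

lemma lti_trajectory_L2:
  fixes A :: "real^'m^'m" and B :: "real^'n^'m"
  assumes "hurwitz A"
  shows "\<exists>c\<ge>0. \<forall>x0 u x. lti_trajectory A B x0 u x \<longrightarrow> u \<in> L2 \<longrightarrow> x \<in> L2 \<and>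
    integral {0..} (\<lambda>t. (norm (x t))\<^sup>2) \<le> c * ((norm x0)\<^sup>2 + integral {0..} (\<lambda>t. (norm (u t))\<^sup>2))"
proof -
  obtain b :: "real^'m \<Rightarrow> real^'m \<Rightarrow> real" where b: "bilinear b" "\<And>x y. b x y = b y x" "\<And>x. b x x \<ge> 0"
      "\<And>x. 2 * b x (A *v x) \<le> - (norm x)\<^sup>2"
    using lyapunov_form[OF assms] by blast
  obtain K where K: "K > 0" "\<And>x y. norm (b x y) \<le> K * norm x * norm y"
    using bilinear_bounded_pos[OF b(1)] by blast
  obtain \<beta> where \<beta>: "\<beta> > 0" "\<And>v. norm (B *v v) \<le> \<beta> * norm v"
    using linear_bounded_pos[OF matrix_vector_mul_linear[of B]] by blast
  \<comment> \<open>The coefficient left for the input when half of the decay of the state absorbs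
    the cross term, which is at most 2 K \<beta> |x| |v|.\<close>
  define d where "d = 2 * (K * \<beta>)\<^sup>2"
  define c where "c = 2 * K + 2 * d"
  have d: "d \<ge> 0" by (simp add: d_def)
  have c: "c \<ge> 0" using K d by (simp add: c_def)
  have dissip: "2 * b x (A *v x + B *v v) \<le> - (norm x)\<^sup>2 / 2 + d * (norm v)\<^sup>2" for x v
  proof -
    have "b x (B *v v) \<le> K * norm x * norm (B *v v)" using K(2)[of x "B *v v"] by simp
    also have "\<dots> \<le> K * norm x * (\<beta> * norm v)" using K(1) \<beta> by (intro mult_left_mono) auto
    also have "2 * (K * norm x * (\<beta> * norm v)) \<le> (norm x)\<^sup>2 / 2 + d * (norm v)\<^sup>2"
      using zero_le_power2[of "norm x - 2 * K * \<beta> * norm v"]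
      by (simp add: d_def power2_eq_square algebra_simps)
    finally have "2 * b x (B *v v) \<le> (norm x)\<^sup>2 / 2 + d * (norm v)\<^sup>2" by simp
    with b(4)[of x] show ?thesis by (simp add: bilinear_radd[OF b(1)])
  qed
  have main: "x \<in> L2 \<and> integral {0..} (\<lambda>t. (norm (x t))\<^sup>2) \<le> c * ((norm x0)\<^sup>2 + integral {0..} (\<lambda>t. (norm (u t))\<^sup>2))"
    if x: "lti_trajectory A B x0 u x" and u: "u \<in> L2" for x0 u x
  proof -
    have x2: "(\<lambda>t. (norm (x t))\<^sup>2) integrable_on {0..T}" for T
      by (intro integrable_continuous_real continuous_intros
          continuous_on_subset[OF lti_trajectory_continuous[OF x]]) auto
    have u2: "(\<lambda>t. (norm (u t))\<^sup>2) integrable_on {0..T}" for T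
      using L2_integrable[OF u] by (rule integrable_on_subinterval) auto
    have bound: "integral {0..T} (\<lambda>t. (norm (x t))\<^sup>2) \<le> c * ((norm x0)\<^sup>2 + integral {0..} (\<lambda>t. (norm (u t))\<^sup>2))"
      if T: "0 \<le> T" for T
    proof -
      \<comment> \<open>The nonnegative value of \<open>b\<close> at time \<open>T\<close> is
        discarded, which leaves a bound uniform in \<open>T\<close>.\<close>
      have "- (K * norm x0 * norm x0) \<le> b (x T) (x T) - b x0 x0"
        using K(2)[of x0 x0] b(3)[of "x T"] by simp
      also have "\<dots> = integral {0..T} (\<lambda>s. 2 * b (x s) (A *v x s + B *v u s))"
        by (rule lti_trajectory_quadratic_form(2)[OF b(1,2) x u T, symmetric])
      also have "\<dots> \<le> integral {0..T} (\<lambda>s. - (norm (x s))\<^sup>2 / 2 + d * (norm (u s))\<^sup>2)"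
      proof (rule integral_le)
        show "(\<lambda>s. 2 * b (x s) (A *v x s + B *v u s)) integrable_on {0..T}"
          using lti_trajectory_quadratic_form(1)[OF b(1,2) x u T] by (rule set_lebesgue_integral_eq_integral)
        show "(\<lambda>s. - (norm (x s))\<^sup>2 / 2 + d * (norm (u s))\<^sup>2) integrable_on {0..T}"
          using integrable_on_mult_right[OF x2[of T], of "-1/2"]
          by (intro integrable_add integrable_on_mult_right u2) auto
      qed (rule dissip)
      also have "\<dots> = - integral {0..T} (\<lambda>t. (norm (x t))\<^sup>2) / 2 + d * integral {0..T} (\<lambda>t. (norm (u t))\<^sup>2)"
        using integrable_on_mult_right[OF x2[of T], of "-1/2"]
          integral_mult_right[of "{0..T}" "-1/2" "\<lambda>t. (norm (x t))\<^sup>2"]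
        by (subst integral_add) (auto intro: u2 integrable_on_mult_right)
      finally have "integral {0..T} (\<lambda>t. (norm (x t))\<^sup>2)
          \<le> 2 * K * (norm x0)\<^sup>2 + 2 * d * integral {0..T} (\<lambda>t. (norm (u t))\<^sup>2)"
        by (simp add: power2_eq_square)
      also have "\<dots> \<le> 2 * K * (norm x0)\<^sup>2 + 2 * d * integral {0..} (\<lambda>t. (norm (u t))\<^sup>2)"
        using d by (intro add_left_mono mult_left_mono integral_subset_le u2 L2_integrable[OF u]) auto
      also have "\<dots> \<le> c * (norm x0)\<^sup>2 + c * integral {0..} (\<lambda>t. (norm (u t))\<^sup>2)"
        using d K by (intro add_mono mult_right_mono integral_nonneg L2_integrable[OF u]) (auto simp: c_def)
      finally show ?thesis by (simp add: algebra_simps)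
    qed
    show ?thesis
      using nonneg_integrable_halfline[OF _ x2 bound] lti_trajectory_measurable[OF x] by (auto simp: L2_iff)
  qed
  show ?thesis using c main by blast
qed

lemma lti_trajectory_concat:
  assumes x: "lti_trajectory A B x0 u x" and y: "lti_trajectory A B (x T) v y" and T: "0 \<le> T"
  shows "lti_trajectory A B x0 (\<lambda>t. if t \<le> T then u t else v (t - T)) (\<lambda>t. if t \<le> T then x t else y (t - T))"
    (is "lti_trajectory A B x0 ?w ?z")
  unfolding lti_trajectory_def
proof (intro allI impI)
  fix t :: real assume t: "0 \<le> t"
  let ?f = "\<lambda>s. A *v x s + B *v u s" and ?g = "\<lambda>s. A *v y s + B *v v s"
    and ?h = "\<lambda>s. A *v ?z s + B *v ?w s"
  have 1: "(?h has_integral x s - x0) {0..s}" if "0 \<le> s" "s \<le> T" for s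
  proof -
    have "(?f has_integral x s - x0) {0..s}" using x that by (simp add: lti_trajectory_def)
    then show ?thesis by (rule has_integral_eq[rotated]) (use that in auto)
  qed
  show "(?h has_integral ?z t - x0) {0..t}"
  proof (cases "t \<le> T")
    case True
    then show ?thesis using 1[OF t] by simp
  next
    case False
    have "(?g has_integral y (t - T) - x T) {0..t - T}"
      using y False by (simp add: lti_trajectory_def)
    from has_integral_shift_real_ivl[OF this, of "- T"]
    have "((\<lambda>s. ?g (s - T)) has_integral y (t - T) - x T) {T..t}" by simp
    \<comment> \<open>At \<open>T\<close> the concatenated input is still \<open>u T\<close>;
      changing one point does not affect the integral.\<close>
    then have "(?h has_integral y (t - T) - x T) {T..t}"
      by (rule has_integral_spike[OF negligible_sing[of T], rotated]) auto
    from has_integral_combine[OF T _ 1[OF T order_refl] this] False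
    show ?thesis by simp
  qed
qed

section \<open>Infima of families of costs as quadratic forms\<close>

text \<open>After subtracting the linear candidate, \<open>h\<close> is additive and vanishes on the
  integers. Hence n h(r) is the value of \<open>h\<close> at the fractional part of n r, bounded
  independently of n, and h(r) = 0.\<close>

lemma additive_bounded_imp_linear:
  fixes g :: "real \<Rightarrow> real"
  assumes add: "\<And>r s. g (r + s) = g r + g s" and bound: "\<And>r. \<bar>r\<bar> \<le> 1 \<Longrightarrow> g r \<le> M"
  shows "g r = r * g 1"
proof -
  define h where "h r = g r - r * g 1" for r
  have h_add: "h (r + s) = h r + h s" for r s
    by (simp add: h_def add algebra_simps)
  have h0: "h 0 = 0" using h_add[of 0 0] by simp
  have h_minus: "h (- r) = - h r" for r using h_add[of r "- r"] h0 by simp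
  have h_nat: "h (real n * r) = real n * h r" for n r
    by (induction n) (simp_all add: h0 h_add algebra_simps)
  have h1: "h 1 = 0" by (simp add: h_def)
  have h_int: "h (of_int k) = 0" for k
  proof (cases k)
    case (nonneg n)
    then show ?thesis using h_nat[of n 1] h1 by simp
  next
    case (neg n)
    then show ?thesis using h_nat[of "Suc n" 1] h1 h_minus[of "real (Suc n)"] by simp
  qed
  have upper: "h r \<le> M + \<bar>g 1\<bar>" if "\<bar>r\<bar> \<le> 1" for r
  proof -
    have "\<bar>r * g 1\<bar> \<le> 1 * \<bar>g 1\<bar>"
      unfolding abs_mult using that by (intro mult_right_mono) auto
    then show ?thesis using bound[OF that] by (simp add: h_def)
  qed
  \<comment> \<open>\<open>h\<close> is odd, so the one-sided bound is two-sided.\<close>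
  have h_bound: "\<bar>h r\<bar> \<le> M + \<bar>g 1\<bar>" if "\<bar>r\<bar> \<le> 1" for r
    using upper[of r] upper[of "- r"] that by (simp add: h_minus)
  have "real n * \<bar>h r\<bar> \<le> M + \<bar>g 1\<bar>" for n
  proof -
    have "h (real n * r) = h (frac (real n * r)) + h (of_int \<lfloor>real n * r\<rfloor>)"
      by (simp add: frac_def flip: h_add)
    then have "\<bar>real n * h r\<bar> = \<bar>h (frac (real n * r))\<bar>"
      by (simp only: h_int h_nat add_0_right)
    then have "real n * \<bar>h r\<bar> = \<bar>h (frac (real n * r))\<bar>"
      by (simp add: abs_mult)
    also have "\<dots> \<le> M + \<bar>g 1\<bar>"
      using frac_lt_1[of "real n * r"] by (intro h_bound) (simp add: frac_ge_0)
    finally show ?thesis .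
  qed
  then have "h r = 0"
    using reals_Archimedean3[of "\<bar>h r\<bar>"] by (metis abs_le_zero_iff not_le)
  then show ?thesis by (simp add: h_def)
qed

text \<open>Homogeneity alone would not make the polar form linear over
  the reals; the quadratic upper bound excludes the pathological additive functions.\<close>

lemma jordan_von_neumann:
  fixes S :: "'a::real_normed_vector \<Rightarrow> real"
  assumes par: "\<And>x y. S (x + y) + S (x - y) = 2 * S x + 2 * S y"
    and hom: "\<And>r x. S (r *\<^sub>R x) = r\<^sup>2 * S x"
    and bound: "\<And>x. S x \<le> c * (norm x)\<^sup>2"
  obtains b where "bilinear b" "\<And>x y. b x y = b y x" "\<And>x. S x = b x x"
proof -
  define b where "b x y = (S (x + y) - S (x - y)) / 4" for x y
  have S_minus: "S (- x) = S x" for x using hom[of "-1" x] by simp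
  have S0: "S 0 = 0" using hom[of 0 0] by simp
  have sym: "b x y = b y x" for x y
    using S_minus[of "x - y"] by (simp add: b_def add.commute)
  have diag: "S x = b x x" for x
    using hom[of 2 x] by (simp add: b_def S0 scaleR_2)
  have mid: "b (x + z) y + b (x - z) y = 2 * b x y" for x y z
  proof -
    have eq: "x + z + y = x + y + z" "x - z + y = x + y - z" "x + z - y = x - y + z" "x - z - y = x - y - z"
      by simp_all
    show ?thesis
      using par[of "x + y" z] par[of "x - y" z] unfolding b_def eq by argo
  qed
  have b0: "b 0 y = 0" for y by (simp add: b_def S_minus)
  have double: "b (2 *\<^sub>R x) y = 2 * b x y" for x y
    using mid[of x x y] by (simp add: b0 scaleR_2)
  have add: "b (p + q) y = b p y + b q y" for p q y
  proof -
    \<comment> \<open>With the half-sum and the half-difference as arguments, \<open>mid\<close> and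
      \<open>double\<close> become additivity.\<close>
    have "(1/2) *\<^sub>R (p + q) + (1/2) *\<^sub>R (p - q) = p" "(1/2) *\<^sub>R (p + q) - (1/2) *\<^sub>R (p - q) = q"
      by (simp_all add: scaleR_add_right scaleR_diff_right flip: scaleR_add_left)
    then show ?thesis
      using mid[of "(1/2) *\<^sub>R (p + q)" "(1/2) *\<^sub>R (p - q)" y] double[of "(1/2) *\<^sub>R (p + q)" y]
      by (simp del: scaleR_add_right)
  qed
  have scale: "b (r *\<^sub>R x) y = r * b x y" for r x y
  proof -
    have "b (s *\<^sub>R x) y \<le> (\<bar>c\<bar> * (norm x + norm y)\<^sup>2 + \<bar>S x\<bar> + \<bar>S y\<bar>) / 2" if "\<bar>s\<bar> \<le> 1" for s
    proof -
      have "norm (s *\<^sub>R x + y) \<le> norm x + norm y"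
        using norm_triangle_ineq[of "s *\<^sub>R x" y] mult_right_mono[OF that norm_ge_zero[of x]] by simp
      then have "(norm (s *\<^sub>R x + y))\<^sup>2 \<le> (norm x + norm y)\<^sup>2" by (intro power_mono) auto
      then have "\<bar>c\<bar> * (norm (s *\<^sub>R x + y))\<^sup>2 \<le> \<bar>c\<bar> * (norm x + norm y)\<^sup>2"
        by (intro mult_left_mono) auto
      moreover have "c * (norm (s *\<^sub>R x + y))\<^sup>2 \<le> \<bar>c\<bar> * (norm (s *\<^sub>R x + y))\<^sup>2"
        by (intro mult_right_mono) auto
      ultimately have "S (s *\<^sub>R x + y) \<le> \<bar>c\<bar> * (norm x + norm y)\<^sup>2"
        using bound[of "s *\<^sub>R x + y"] by linarith
      moreover have "s\<^sup>2 \<le> 1" using that by (simp add: abs_square_le_1)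
      then have "\<bar>s\<^sup>2 * S x\<bar> \<le> 1 * \<bar>S x\<bar>" unfolding abs_mult by (intro mult_right_mono) auto
      \<comment> \<open>The parallelogram law leaves \<open>S\<close> at the moving vector with a
        positive sign only, so the one-sided bound on \<open>S\<close> is enough.\<close>
      moreover have "b (s *\<^sub>R x) y = (S (s *\<^sub>R x + y) - s\<^sup>2 * S x - S y) / 2"
        using par[of "s *\<^sub>R x" y] by (simp add: b_def hom)
      ultimately show ?thesis
        using abs_ge_minus_self[of "S y"] by (simp add: abs_le_iff)
    qed
    from additive_bounded_imp_linear[of "\<lambda>s. b (s *\<^sub>R x) y", OF _ this]
    show ?thesis by (simp add: add scaleR_add_left)
  qed
  have "bilinear b"
    unfolding bilinear_def by (intro conjI allI linearI) (metis add scale sym real_scaleR_def)+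
  with that sym diag show ?thesis by blast
qed

text \<open>Passing to infima turns the identities for single elements into inequalities. They
  become equalities because the operations can be undone: scaling by 1 / r, and the parallelogram
  construction applied to x + y and x - y, which returns 2 x and 2 y.\<close>

lemma Inf_quadratic:
  fixes K :: "'a::real_normed_vector \<Rightarrow> real set"
  defines "S \<equiv> \<lambda>x. Inf (K x)"
  assumes bdd: "\<And>x. bdd_below (K x)" and nonneg: "\<And>a. a \<in> K 0 \<Longrightarrow> 0 \<le> a"
    and par: "\<And>x y a b. a \<in> K x \<Longrightarrow> b \<in> K y \<Longrightarrow> \<exists>c\<in>K (x + y). \<exists>d\<in>K (x - y). c + d = 2 * a + 2 * b"
    and hom: "\<And>r x a. a \<in> K x \<Longrightarrow> r\<^sup>2 * a \<in> K (r *\<^sub>R x)"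
    and upper: "\<And>x. \<exists>a\<in>K x. a \<le> c * (norm x)\<^sup>2"
  obtains b where "bilinear b" "\<And>x y. b x y = b y x" "\<And>x. S x = b x x"
proof -
  have ne: "K x \<noteq> {}" for x using upper[of x] by auto
  have lower: "S x \<le> a" if "a \<in> K x" for x a
    using that bdd unfolding S_def by (rule cInf_lower)
  have greatest: "v \<le> S x" if "\<And>a. a \<in> K x \<Longrightarrow> v \<le> a" for x v
    using that ne unfolding S_def by (intro cInf_greatest)
  have S0: "S 0 = 0"
  proof (rule antisym)
    obtain a where "a \<in> K 0" using ne by blast
    from lower[OF hom[OF this, of 0]] show "S 0 \<le> 0" by simp
    show "0 \<le> S 0" using nonneg by (rule greatest)
  qed
  have hom_le: "S (r *\<^sub>R x) \<le> r\<^sup>2 * S x" if "r \<noteq> 0" for r x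
  proof -
    have "S (r *\<^sub>R x) / r\<^sup>2 \<le> S x"
    proof (rule greatest)
      fix a assume "a \<in> K x"
      from lower[OF hom[OF this, of r]] show "S (r *\<^sub>R x) / r\<^sup>2 \<le> a"
        using that by (simp add: field_simps)
    qed
    then show ?thesis using that by (simp add: field_simps)
  qed
  have S_hom: "S (r *\<^sub>R x) = r\<^sup>2 * S x" for r x
  proof (cases "r = 0")
    case True
    then show ?thesis by (simp add: S0)
  next
    case False
    have "S x \<le> (1 / r)\<^sup>2 * S (r *\<^sub>R x)" using hom_le[of "1 / r" "r *\<^sub>R x"] False by simp
    then have "r\<^sup>2 * S x \<le> S (r *\<^sub>R x)" using False by (simp add: field_simps)
    with hom_le[OF False, of x] show ?thesis by simp
  qed
  have par_le: "S (x + y) + S (x - y) \<le> 2 * S x + 2 * S y" for x y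
  proof -
    have *: "S (x + y) + S (x - y) \<le> 2 * a + 2 * b" if a: "a \<in> K x" and b: "b \<in> K y" for a b
    proof -
      obtain c d where "c \<in> K (x + y)" "d \<in> K (x - y)" "c + d = 2 * a + 2 * b"
        using par[OF a b] by blast
      with lower show ?thesis by (metis add_mono)
    qed
    have "(S (x + y) + S (x - y) - 2 * b) / 2 \<le> S x" if "b \<in> K y" for b
      by (rule greatest) (use *[OF _ that] in \<open>simp add: field_simps\<close>)
    then have "(S (x + y) + S (x - y) - 2 * S x) / 2 \<le> b" if "b \<in> K y" for b
      using that by (force simp: field_simps)
    then have "(S (x + y) + S (x - y) - 2 * S x) / 2 \<le> S y" by (rule greatest)
    then show ?thesis by simp
  qed
  have par_eq: "S (x + y) + S (x - y) = 2 * S x + 2 * S y" for x y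
  proof (rule antisym[OF par_le])
    have "S (2 *\<^sub>R x) + S (2 *\<^sub>R y) \<le> 2 * S (x + y) + 2 * S (x - y)"
      using par_le[of "x + y" "x - y"] by (simp add: scaleR_2 algebra_simps)
    then show "2 * S x + 2 * S y \<le> S (x + y) + S (x - y)" by (simp add: S_hom)
  qed
  have "S x \<le> c * (norm x)\<^sup>2" for x
    using upper[of x] lower by (meson order.trans)
  from jordan_von_neumann[OF par_eq S_hom this] that show ?thesis by blast
qed

lemma bilinear_imp_matrix:
  fixes b :: "real^'m \<Rightarrow> real^'m \<Rightarrow> real"
  assumes b: "bilinear b" and sym: "\<And>x y. b x y = b y x"
  obtains P where "sym_mat P" "\<And>x y. x \<bullet> (P *v y) = b x y"
proof -
  define P :: "real^'m^'m" where "P = (\<chi> i j. b (axis i 1) (axis j 1))"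
  have "sym_mat P"
    by (simp add: sym_mat_def P_def transpose_def vec_eq_iff sym)
  moreover have "x \<bullet> (P *v y) = b x y" for x y
  proof -
    have "b x y = b (\<Sum>i\<in>UNIV. x $ i *\<^sub>R axis i 1) (\<Sum>j\<in>UNIV. y $ j *\<^sub>R axis j 1)"
      using basis_expansion[of x] basis_expansion[of y] by (simp add: scalar_mult_eq_scaleR)
    also have "\<dots> = (\<Sum>i\<in>UNIV. \<Sum>j\<in>UNIV. y $ j * (x $ i * b (axis i 1) (axis j 1)))"
      by (simp add: bilinear_sum[OF b] sum.cartesian_product bilinear_lmul[OF b] bilinear_rmul[OF b])
    also have "\<dots> = x \<bullet> (P *v y)"
      by (simp add: inner_vec_def matrix_vector_mult_def P_def sum_distrib_left mult_ac)
    finally show ?thesis by simp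
  qed
  ultimately show ?thesis using that by blast
qed

section \<open>Block matrices\<close>

lemma sum_UNIV_sum:
  "(\<Sum>i\<in>(UNIV::('a::finite + 'b::finite) set). f i) = (\<Sum>i\<in>UNIV. f (Inl i)) + (\<Sum>i\<in>UNIV. f (Inr i))"
  using sum.Plus[of "UNIV::'a set" "UNIV::'b set" f] by (simp add: o_def)

lemma block_mat_mult_block_vec:
  "block_mat M N K L *v block_vec v w = block_vec (M *v v + N *v w) (K *v v + L *v w)"
  by (simp add: vec_eq_iff block_mat_def block_vec_def matrix_vector_mult_def sum_UNIV_sum split: sum.split)

lemma inner_block_vec: "block_vec a b \<bullet> block_vec c d = a \<bullet> c + b \<bullet> d"
  by (simp add: inner_vec_def block_vec_def sum_UNIV_sum)

lemma transpose_block_mat: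
  "transpose (block_mat M N K L) = block_mat (transpose M) (transpose K) (transpose N) (transpose L)"
  by (simp add: vec_eq_iff block_mat_def transpose_def split: sum.split)

lemma block_vec_cases: obtains x y where "v = block_vec x y"
proof
  show "v = block_vec (\<chi> i. v $ Inl i) (\<chi> i. v $ Inr i)"
    by (simp add: vec_eq_iff block_vec_def split: sum.split)
qed

lemma inner_vector_matrix_mult: "v \<bullet> (w v* X) = (X *v v) \<bullet> w" for X :: "real^'k^'l"
  using dot_lmul_matrix[of w X v] by (simp add: inner_commute)

text \<open>The form of \<open>kron2 Q (mat 1)\<close> for symmetric \<open>Q\<close>, with the two
  off-diagonal terms merged. It is the common currency of the three conditions.\<close>

definition supply_rate :: "real^2^2 \<Rightarrow> real^'n \<Rightarrow> real^'n \<Rightarrow> real" where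
  "supply_rate Q y u = Q $ 1 $ 1 * (y \<bullet> y) + 2 * (Q $ 1 $ 2 * (y \<bullet> u)) + Q $ 2 $ 2 * (u \<bullet> u)"

lemma sym_mat_nth:
  assumes "sym_mat Q"
  shows "Q $ i $ j = Q $ j $ i"
proof -
  have "transpose Q $ i $ j = Q $ i $ j" using assms by (simp add: sym_mat_def)
  then show ?thesis by (simp add: transpose_def)
qed

lemma kron2_form:
  assumes "sym_mat Q"
  shows "block_vec y u \<bullet> (kron2 Q (mat 1) *v block_vec y u) = supply_rate Q y u"
  by (simp add: kron2_def block_mat_mult_block_vec inner_block_vec supply_rate_def sym_mat_nth[OF assms, of 2 1]
      scaleR_matrix_vector_assoc[symmetric] inner_add inner_commute[of u y])

lemma transpose_kron2:
  assumes "sym_mat Q"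
  shows "transpose (kron2 Q M) = kron2 Q (transpose M)"
  by (simp add: kron2_def transpose_block_mat sym_mat_nth[OF assms, of 2 1] transpose_scalar)

lemma Theta_form:
  assumes "sym_mat Q"
  shows "block_vec x u \<bullet> (Theta C D Q *v block_vec x u) = supply_rate Q (C *v x + D *v u) u"
  by (simp add: Theta_def matrix_vector_mul_assoc[symmetric] inner_vector_matrix_mult
      block_mat_mult_block_vec kron2_form[OF assms])

lemma transpose_0 [simp]: "transpose 0 = 0"
  by (simp add: transpose_def vec_eq_iff)

text \<open>Evaluating the block matrix at (x, u) gives the pointwise dissipation inequality;
  symmetry of \<open>P\<close> merges the two cross terms. The definition of semidefiniteness also
  demands that the block matrix be symmetric.\<close>

lemma lmi_feasible_iff:
  fixes A :: "real^'m^'m" and B :: "real^'n^'m"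
  assumes Q: "sym_mat Q"
  shows "lmi_feasible A B C D Q \<longleftrightarrow>
    (\<exists>P. sym_mat P \<and> (\<forall>x u. 2 * (x \<bullet> (P *v (A *v x + B *v u))) \<le> supply_rate Q (C *v x + D *v u) u))"
proof -
  define M where "M P = transpose (block_mat A B (mat 1) 0) ** block_mat 0 P P 0 ** block_mat A B (mat 1) 0
      - Theta C D Q" for P
  have form: "block_vec x u \<bullet> (M P *v block_vec x u)
      = 2 * (x \<bullet> (P *v (A *v x + B *v u))) - supply_rate Q (C *v x + D *v u) u"
    if "sym_mat P" for P x u
  proof -
    have "(A *v x + B *v u) \<bullet> (P *v x) = x \<bullet> (P *v (A *v x + B *v u))"
      using that by (metis inner_commute dot_lmul_matrix sym_mat_def transpose_matrix_vector)
    then show ?thesis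
      by (simp add: M_def matrix_vector_mult_diff_rdistrib matrix_vector_mul_assoc[symmetric]
          inner_vector_matrix_mult block_mat_mult_block_vec inner_block_vec inner_diff_right Theta_form[OF Q])
  qed
  have sym: "sym_mat (M P)" if "sym_mat P" for P
  proof -
    have "transpose (Theta C D Q) = Theta C D Q"
      by (simp add: Theta_def transpose_kron2[OF Q] matrix_transpose_mul matrix_mul_assoc)
    moreover have "transpose (block_mat 0 P P (0 :: real^'m^'m)) = block_mat 0 P P 0"
      using that by (simp add: transpose_block_mat sym_mat_def)
    moreover have "transpose (X - Y) = transpose X - transpose Y" for X Y :: "real^('m + 'n)^('m + 'n)"
      by (simp add: transpose_def vec_eq_iff)
    ultimately show ?thesis
      by (simp add: sym_mat_def M_def matrix_transpose_mul matrix_mul_assoc)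
  qed
  have "neg_semidef (M P) \<longleftrightarrow>
      (\<forall>x u. 2 * (x \<bullet> (P *v (A *v x + B *v u))) \<le> supply_rate Q (C *v x + D *v u) u)"
    if "sym_mat P" for P
  proof -
    have "(\<forall>v. v \<bullet> (M P *v v) \<le> 0) \<longleftrightarrow> (\<forall>x u. block_vec x u \<bullet> (M P *v block_vec x u) \<le> 0)"
      by (metis block_vec_cases)
    then show ?thesis using that by (simp add: neg_semidef_def sym form)
  qed
  then show ?thesis unfolding lmi_feasible_def M_def[symmetric] by blast
qed

section \<open>The integral quadratic constraint and the scaled graph\<close>

lemma lti_trajectory_in_L2:
  fixes A :: "real^'m^'m" and B :: "real^'n^'m"
  assumes A: "hurwitz A" and x: "lti_trajectory A B x0 u x" and u: "u \<in> L2"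
  shows "x \<in> L2"
  using lti_trajectory_L2[OF A, of B] x u by blast

lemma l2_inner_eq_integral:
  assumes "u \<in> L2" "y \<in> L2"
  shows "l2_inner u y = integral {0..} (\<lambda>t. u t \<bullet> y t)"
  unfolding l2_inner_def
  by (rule lebesgue_integral_eq_integral) (auto simp: integrable_lebesgue_on_iff L2_inner[OF assms])

lemma l2_inner_commute: "l2_inner u y = l2_inner y u"
  by (simp add: l2_inner_def inner_commute)

lemma l2_inner_self_nonneg: "0 \<le> l2_inner u u"
  by (simp add: l2_inner_def)

lemma l2_norm_power2: "(l2_norm u)\<^sup>2 = l2_inner u u"
  by (simp add: l2_norm_def l2_inner_self_nonneg)

lemma l2_norm_nonneg: "0 \<le> l2_norm u"
  by (simp add: l2_norm_def l2_inner_self_nonneg)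

lemma l2_norm_eq_0_iff: "l2_norm u = 0 \<longleftrightarrow> l2_inner u u = 0"
  by (simp add: l2_norm_def)

lemma supply_rate_integrable:
  assumes "y \<in> L2" "u \<in> L2"
  shows "(\<lambda>t. supply_rate Q (y t) (u t)) absolutely_integrable_on {0..}"
  unfolding supply_rate_def using assms
  by (intro set_integral_add set_integrable_mult_right L2_inner)

lemma integral_supply_rate:
  fixes y u :: "real \<Rightarrow> real^'n"
  assumes y: "y \<in> L2" and u: "u \<in> L2"
  shows "integral {0..} (\<lambda>t. supply_rate Q (y t) (u t))
    = Q $ 1 $ 1 * l2_inner y y + 2 * (Q $ 1 $ 2 * l2_inner y u) + Q $ 2 $ 2 * l2_inner u u"
proof -
  have int: "((\<lambda>t. v t \<bullet> w t) has_integral l2_inner v w) {0..}" if "v \<in> L2" "w \<in> L2" for v w :: "real \<Rightarrow> real^'n"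
    using L2_inner[OF that] unfolding l2_inner_eq_integral[OF that]
    by (intro integrable_integral set_lebesgue_integral_eq_integral(1))
  show ?thesis
    unfolding supply_rate_def
    by (intro integral_unique has_integral_add has_integral_mult_right int y u)
qed

lemma l2_Cauchy_Schwarz:
  fixes u y :: "real \<Rightarrow> real^'n"
  assumes u: "u \<in> L2" and y: "y \<in> L2" and pos: "l2_inner u u > 0"
  shows "\<bar>l2_inner u y\<bar> \<le> l2_norm u * l2_norm y"
proof -
  define a where "a = l2_inner u u"
  define p where "p = l2_inner u y"
  \<comment> \<open>Chosen so that the supply rate is the square of a v - p w, whose integral is
    nonnegative and already computed; the classical proof of Cauchy-Schwarz.\<close>
  define Q :: "real^2^2" where "Q = (\<chi> i j. if i = 1 then (if j = 1 then a\<^sup>2 else - a * p) else p\<^sup>2)"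
  have "supply_rate Q v w = (norm (a *\<^sub>R v - p *\<^sub>R w))\<^sup>2" for v w :: "real^'n"
    unfolding power2_norm_eq_inner
    by (simp add: supply_rate_def Q_def inner_diff inner_commute[of w v] power2_eq_square algebra_simps)
  then have "0 \<le> integral {0..} (\<lambda>t. supply_rate Q (y t) (u t))"
    using set_lebesgue_integral_eq_integral(1)[OF supply_rate_integrable[OF y u, of Q]]
    by (intro integral_nonneg) auto
  also have "\<dots> = a * (a * l2_inner y y - p\<^sup>2)"
    by (simp add: integral_supply_rate[OF y u] Q_def a_def[symmetric] p_def[symmetric]
        l2_inner_commute[of y u] power2_eq_square algebra_simps)
  finally have "p\<^sup>2 \<le> a * l2_inner y y"
    using pos by (simp add: a_def zero_le_mult_iff)
  also have "\<dots> = (l2_norm u * l2_norm y)\<^sup>2"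
    by (simp add: power_mult_distrib l2_norm_power2 a_def)
  finally show ?thesis
    unfolding p_def by (rule abs_le_square_iff[THEN iffD2, THEN order.trans])
      (simp add: l2_norm_nonneg)
qed

lemma sg_angle_cos:
  assumes u: "u \<in> L2" and y: "y \<in> L2" and pos: "l2_inner u u > 0"
  shows "sg_gain u y * cos (sg_angle u y) = l2_inner u y / l2_inner u u"
proof -
  have nu: "l2_norm u > 0" using pos by (simp add: l2_norm_def)
  note cs = l2_Cauchy_Schwarz[OF assms]
  show ?thesis
  proof (cases "l2_norm y = 0")
    case True
    \<comment> \<open>The angle is 0 by convention here, but the gain vanishes, and Cauchy-Schwarz
      makes the inner product vanish as well.\<close>
    then show ?thesis using cs by (simp add: sg_gain_def)
  next
    case False
    then have ny: "l2_norm y > 0" using l2_norm_nonneg[of y] by simp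
    have "\<bar>l2_inner u y / (l2_norm u * l2_norm y)\<bar> \<le> 1"
      using cs nu ny by (simp add: abs_mult)
    then have "cos (sg_angle u y) = l2_inner u y / (l2_norm u * l2_norm y)"
      using False by (simp add: sg_angle_def cos_arccos_abs)
    then show ?thesis
      using nu ny by (simp add: sg_gain_def l2_norm_power2[symmetric] power2_eq_square)
  qed
qed

lemma S_region_iff:
  assumes "sym_mat Q"
  shows "z \<in> S_region Q \<longleftrightarrow> 0 \<le> Q $ 1 $ 1 * (norm z)\<^sup>2 + 2 * (Q $ 1 $ 2 * Re z) + Q $ 2 $ 2"
  unfolding cmod_power2
  by (simp add: S_region_def Let_def sum_2 sym_mat_nth[OF assms, of 2 1] power2_eq_square algebra_simps)

text \<open>The region sees \<open>z\<close> only through its modulus and real part, which do not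
  depend on the sign of the angle, so both conjugate points are treated at once.\<close>

lemma sg_point_in_S_region:
  assumes Q: "sym_mat Q" and u: "u \<in> L2" and y: "y \<in> L2" and pos: "l2_inner u u > 0"
    and z: "z = rcis (sg_gain u y) (sg_angle u y) \<or> z = rcis (sg_gain u y) (- sg_angle u y)"
  shows "z \<in> S_region Q \<longleftrightarrow> 0 \<le> integral {0..} (\<lambda>t. supply_rate Q (y t) (u t))"
proof -
  have Re: "Re z = l2_inner u y / l2_inner u u"
    using z sg_angle_cos[OF u y pos] by auto
  have "(norm z)\<^sup>2 = (sg_gain u y)\<^sup>2" using z by auto
  also have "\<dots> = l2_inner y y / l2_inner u u"
    by (simp add: sg_gain_def power_divide l2_norm_power2)
  finally have "Q $ 1 $ 1 * (norm z)\<^sup>2 + 2 * (Q $ 1 $ 2 * Re z) + Q $ 2 $ 2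
      = integral {0..} (\<lambda>t. supply_rate Q (y t) (u t)) / l2_inner u u"
    using pos by (simp add: Re integral_supply_rate[OF y u] l2_inner_commute[of y u] add_divide_distrib)
  then show ?thesis
    using pos by (simp add: S_region_iff[OF Q] zero_le_divide_iff)
qed

lemma scaled_graph_subset_iff:
  fixes H :: "(real \<Rightarrow> real^'n) \<Rightarrow> real \<Rightarrow> real^'n"
  assumes Q: "sym_mat Q" and H: "\<And>u. u \<in> L2 \<Longrightarrow> H u \<in> L2"
  shows "scaled_graph H \<subseteq> S_region Q \<longleftrightarrow>
    (\<forall>u\<in>L2. l2_norm u \<noteq> 0 \<longrightarrow> 0 \<le> integral {0..} (\<lambda>t. supply_rate Q (H u t) (u t)))"
proof -
  have pos: "l2_inner u u > 0" if "l2_norm u \<noteq> 0" for u :: "real \<Rightarrow> real^'n"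
    using that l2_inner_self_nonneg[of u] by (simp add: l2_norm_eq_0_iff)
  show ?thesis
  proof
    assume sub: "scaled_graph H \<subseteq> S_region Q"
    show "\<forall>u\<in>L2. l2_norm u \<noteq> 0 \<longrightarrow> 0 \<le> integral {0..} (\<lambda>t. supply_rate Q (H u t) (u t))"
    proof (intro ballI impI)
      fix u :: "real \<Rightarrow> real^'n" assume u: "u \<in> L2" "l2_norm u \<noteq> 0"
      then have "rcis (sg_gain u (H u)) (sg_angle u (H u)) \<in> S_region Q"
        using sub by (auto simp: scaled_graph_def)
      then show "0 \<le> integral {0..} (\<lambda>t. supply_rate Q (H u t) (u t))"
        using sg_point_in_S_region[OF Q u(1) H[OF u(1)] pos[OF u(2)]] by blast
    qed
  next
    assume iqc: "\<forall>u\<in>L2. l2_norm u \<noteq> 0 \<longrightarrow> 0 \<le> integral {0..} (\<lambda>t. supply_rate Q (H u t) (u t))"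
    show "scaled_graph H \<subseteq> S_region Q"
    proof
      fix z assume "z \<in> scaled_graph H"
      then obtain u where u: "u \<in> L2" "l2_norm u \<noteq> 0"
        and z: "z = rcis (sg_gain u (H u)) (sg_angle u (H u)) \<or> z = rcis (sg_gain u (H u)) (- sg_angle u (H u))"
        by (auto simp: scaled_graph_def)
      from iqc u show "z \<in> S_region Q"
        using sg_point_in_S_region[OF Q u(1) H[OF u(1)] pos[OF u(2)] z] by blast
    qed
  qed
qed

lemma iqc_holds_iff:
  assumes Q: "sym_mat Q" and H: "\<And>u. u \<in> L2 \<Longrightarrow> H u \<in> L2"
  shows "iqc_holds H Q \<longleftrightarrow> (\<forall>u\<in>L2. 0 \<le> integral {0..} (\<lambda>t. supply_rate Q (H u t) (u t)))"
proof -
  have "(LINT t|lebesgue_on {0..}. supply_rate Q (H u t) (u t))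
      = integral {0..} (\<lambda>t. supply_rate Q (H u t) (u t))" if "u \<in> L2" for u
    by (rule lebesgue_integral_eq_integral)
      (auto simp: integrable_lebesgue_on_iff supply_rate_integrable[OF H[OF that] that])
  then show ?thesis by (simp add: iqc_holds_def kron2_form[OF Q])
qed

section \<open>Square-integrable outputs and quadratic bounds on the cost\<close>

lemma lti_output_L2:
  assumes "x \<in> L2" "u \<in> L2"
  shows "(\<lambda>t. C *v x t + D *v u t) \<in> L2"
  using assms by (intro L2_add L2_matrix_vector_mult)

lemma lti_system_L2:
  assumes "hurwitz A" and u: "u \<in> L2"
  shows "lti_system A B C D u \<in> L2"
proof -
  have "lti_state A B u \<in> L2"
    by (rule lti_trajectory_in_L2[OF assms(1) lti_state_trajectory[OF u] u])
  from lti_output_L2[OF this u] show ?thesis by (simp add: lti_system_def[abs_def])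
qed

lemma supply_rate_bound:
  fixes C :: "real^'m^'n" and D :: "real^'n^'n"
  shows "\<exists>k\<ge>0. \<forall>x u. \<bar>supply_rate Q (C *v x + D *v u) u\<bar> \<le> k * ((norm x)\<^sup>2 + (norm u)\<^sup>2)"
proof -
  define y where "y z = C *v fst z + D *v snd z" for z :: "(real^'m) \<times> (real^'n)"
  \<comment> \<open>The polar form of the supply rate on pairs (x, u); boundedness of bilinear forms
    then yields the constant.\<close>
  define b where "b z w = Q $ 1 $ 1 * (y z \<bullet> y w) + Q $ 1 $ 2 * (y z \<bullet> snd w + snd z \<bullet> y w)
    + Q $ 2 $ 2 * (snd z \<bullet> snd w)" for z w
  have "y (z + w) = y z + y w" "y (r *\<^sub>R z) = r *\<^sub>R y z" for z w r
    by (simp_all add: y_def matrix_vector_right_distrib matrix_vector_mult_scaleR scaleR_add_right)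
  then have lin: "linear y" by (rule linearI)
  have "bilinear b"
    unfolding bilinear_def
  proof (intro allI conjI linearI)
    note lin = linear_add[OF lin] linear_cmul[OF lin]
    fix v z w :: "(real^'m) \<times> (real^'n)" and r :: real
    show "b v (z + w) = b v z + b v w"
      by (simp add: b_def lin inner_add_right distrib_left)
    show "b (z + w) v = b z v + b w v"
      by (simp add: b_def lin inner_add_left distrib_left)
    show "b v (r *\<^sub>R z) = r *\<^sub>R b v z" "b (r *\<^sub>R z) v = r *\<^sub>R b z v"
      by (simp_all add: b_def lin algebra_simps)
  qed
  from bilinear_bounded_pos[OF this]
  obtain k where k: "k > 0" "\<And>z w. norm (b z w) \<le> k * norm z * norm w" by blast
  have "\<bar>supply_rate Q (C *v x + D *v u) u\<bar> \<le> k * ((norm x)\<^sup>2 + (norm u)\<^sup>2)" for x u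
  proof -
    have "supply_rate Q (C *v x + D *v u) u = b (x, u) (x, u)"
      by (simp add: supply_rate_def b_def y_def inner_commute[of u "C *v x + D *v u"])
    moreover have "norm (x, u) * norm (x, u) = (norm x)\<^sup>2 + (norm u)\<^sup>2"
      by (simp add: norm_Pair)
    ultimately show ?thesis
      using k(2)[of "(x, u)" "(x, u)"] by (simp only: mult.assoc real_norm_def)
  qed
  with k(1) show ?thesis by (intro exI[of _ k]) auto
qed

text \<open>Used at both extremes: for \<open>x0 = 0\<close> it shows that inputs of norm zero have
  zero cost, and for the zero input it bounds the optimal cost quadratically in
  \<open>x0\<close>.\<close>

lemma integral_supply_rate_bound:
  fixes A :: "real^'m^'m" and B :: "real^'n^'m" and C :: "real^'m^'n" and D :: "real^'n^'n"
  assumes A: "hurwitz A"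
  shows "\<exists>k\<ge>0. \<forall>x0 u x. lti_trajectory A B x0 u x \<longrightarrow> u \<in> L2 \<longrightarrow>
    \<bar>integral {0..} (\<lambda>t. supply_rate Q (C *v x t + D *v u t) (u t))\<bar> \<le> k * ((norm x0)\<^sup>2 + l2_inner u u)"
proof -
  obtain c where c: "c \<ge> 0"
    "\<And>x0 u x. lti_trajectory A B x0 u x \<Longrightarrow> u \<in> L2 \<Longrightarrow>
       integral {0..} (\<lambda>t. (norm (x t))\<^sup>2) \<le> c * ((norm x0)\<^sup>2 + integral {0..} (\<lambda>t. (norm (u t))\<^sup>2))"
    using lti_trajectory_L2[OF A, of B] by blast
  obtain k where k: "k \<ge> 0"
    "\<And>x u. \<bar>supply_rate Q (C *v x + D *v u) u\<bar> \<le> k * ((norm x)\<^sup>2 + (norm u)\<^sup>2)"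
    using supply_rate_bound[of Q C D] by blast
  have "\<bar>integral {0..} (\<lambda>t. supply_rate Q (C *v x t + D *v u t) (u t))\<bar>
      \<le> (k * (c + 1)) * ((norm x0)\<^sup>2 + l2_inner u u)"
    if x: "lti_trajectory A B x0 u x" and u: "u \<in> L2" for x0 u x
  proof -
    have xL: "x \<in> L2" by (rule lti_trajectory_in_L2[OF A x u])
    have uu: "l2_inner u u = integral {0..} (\<lambda>t. (norm (u t))\<^sup>2)"
      by (simp add: l2_inner_eq_integral[OF u u] power2_norm_eq_inner)
    have "norm (integral {0..} (\<lambda>t. supply_rate Q (C *v x t + D *v u t) (u t)))
        \<le> integral {0..} (\<lambda>t. k * ((norm (x t))\<^sup>2 + (norm (u t))\<^sup>2))"
      using supply_rate_integrable[OF lti_output_L2[OF xL u] u] k(2)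
      by (intro integral_norm_bound_integral integrable_on_mult_right integrable_add L2_integrable xL u)
        (auto simp: set_lebesgue_integral_eq_integral(1))
    also have "\<dots> = k * (integral {0..} (\<lambda>t. (norm (x t))\<^sup>2) + l2_inner u u)"
      by (simp add: integral_add L2_integrable xL u uu)
    also have "\<dots> \<le> k * (c * ((norm x0)\<^sup>2 + l2_inner u u) + ((norm x0)\<^sup>2 + l2_inner u u))"
    proof (intro mult_left_mono k(1))
      show "integral {0..} (\<lambda>t. (norm (x t))\<^sup>2) + l2_inner u u
          \<le> c * ((norm x0)\<^sup>2 + l2_inner u u) + ((norm x0)\<^sup>2 + l2_inner u u)"
        using c(2)[OF x u] zero_le_power2[of "norm x0"] unfolding uu by linarith
    qed
    finally show ?thesis by (simp add: algebra_simps)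
  qed
  with k(1) c(1) show ?thesis by (intro exI[of _ "k * (c + 1)"]) auto
qed

lemma iqc_holds_lti_iff:
  assumes A: "hurwitz A" and Q: "sym_mat Q"
  shows "iqc_holds (lti_system A B C D) Q \<longleftrightarrow>
    (\<forall>u\<in>L2. 0 \<le> integral {0..} (\<lambda>t. supply_rate Q (lti_system A B C D u t) (u t)))"
  using iqc_holds_iff[OF Q] lti_system_L2[OF A] by blast

text \<open>Signals are functions, so norm zero does not mean \<open>u = 0\<close>. Such inputs are
  invisible in the scaled graph, but their integral is 0 and the constraint holds for them.\<close>

lemma iqc_iff_scaled_graph:
  fixes A :: "real^'m^'m" and B :: "real^'n^'m" and C :: "real^'m^'n" and D :: "real^'n^'n"
  assumes A: "hurwitz A" and Q: "sym_mat Q"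
  shows "iqc_holds (lti_system A B C D) Q \<longleftrightarrow> scaled_graph (lti_system A B C D) \<subseteq> S_region Q"
proof -
  obtain k where "k \<ge> 0" and k: "\<And>x0 u x. lti_trajectory A B x0 u x \<Longrightarrow> u \<in> L2 \<Longrightarrow>
    \<bar>integral {0..} (\<lambda>t. supply_rate Q (C *v x t + D *v u t) (u t))\<bar> \<le> k * ((norm x0)\<^sup>2 + l2_inner u u)"
    using integral_supply_rate_bound[OF A, of B Q C D] by blast
  have zero: "integral {0..} (\<lambda>t. supply_rate Q (lti_system A B C D u t) (u t)) = 0"
    if "u \<in> L2" "l2_norm u = 0" for u
    using k[OF lti_state_trajectory[OF that(1)] that(1)] that(2)
    by (simp add: lti_system_def[abs_def] l2_norm_eq_0_iff)
  have "scaled_graph (lti_system A B C D) \<subseteq> S_region Q \<longleftrightarrow>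
    (\<forall>u\<in>L2. l2_norm u \<noteq> 0 \<longrightarrow> 0 \<le> integral {0..} (\<lambda>t. supply_rate Q (lti_system A B C D u t) (u t)))"
    using scaled_graph_subset_iff[OF Q] lti_system_L2[OF A] by blast
  then show ?thesis
    unfolding iqc_holds_lti_iff[OF A Q] using zero by fastforce
qed

section \<open>From the matrix inequality to the integral quadratic constraint\<close>

text \<open>A substitute for convergence of the state to 0: a positive lower bound on a half-line
  would give an arbitrarily large integral.\<close>

lemma L2_not_bounded_away:
  assumes x: "x \<in> L2" and "\<delta> > 0"
  shows "\<not> eventually (\<lambda>t. \<delta> \<le> (norm (x t))\<^sup>2) at_top"
proof
  assume "eventually (\<lambda>t. \<delta> \<le> (norm (x t))\<^sup>2) at_top"
  then obtain a where a: "\<And>t. a \<le> t \<Longrightarrow> \<delta> \<le> (norm (x t))\<^sup>2"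
    by (auto simp: eventually_at_top_linorder)
  define b where "b = max a 0"
  define I where "I = integral {0..} (\<lambda>t. (norm (x t))\<^sup>2)"
  have "\<delta> * r \<le> I" if "0 \<le> r" for r
  proof -
    have int: "(\<lambda>t. (norm (x t))\<^sup>2) integrable_on {b..b + r}"
      using L2_integrable[OF x] by (rule integrable_on_subinterval) (auto simp: b_def)
    have "\<delta> * r = integral {b..b + r} (\<lambda>t. \<delta>)" using that by simp
    also have "\<dots> \<le> integral {b..b + r} (\<lambda>t. (norm (x t))\<^sup>2)"
      using a int by (intro integral_le) (auto simp: b_def)
    also have "\<dots> \<le> I"
      unfolding I_def by (intro integral_subset_le int L2_integrable[OF x]) (auto simp: b_def)
    finally show ?thesis .
  qed
  from this[of "(\<bar>I\<bar> + 1) / \<delta>"] \<open>\<delta> > 0\<close> have "\<bar>I\<bar> + 1 \<le> I" by simp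
  then show False by simp
qed

lemma lmi_imp_iqc:
  fixes A :: "real^'m^'m" and B :: "real^'n^'m" and C :: "real^'m^'n" and D :: "real^'n^'n"
  assumes A: "hurwitz A" and Q: "sym_mat Q" and lmi: "lmi_feasible A B C D Q"
  shows "iqc_holds (lti_system A B C D) Q"
  unfolding iqc_holds_lti_iff[OF A Q]
proof
  fix u :: "real \<Rightarrow> real^'n" assume u: "u \<in> L2"
  obtain P where P: "sym_mat P"
    "\<And>x u. 2 * (x \<bullet> (P *v (A *v x + B *v u))) \<le> supply_rate Q (C *v x + D *v u) u"
    using lmi lmi_feasible_iff[OF Q] by blast
  define p where "p v w = v \<bullet> (P *v w)" for v w
  have p: "bilinear p"
    unfolding bilinear_def p_def
    by (auto intro!: linearI simp: inner_add matrix_vector_right_distrib matrix_vector_mult_scaleR)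
  have psym: "p v w = p w v" for v w
    using P(1) by (metis p_def sym_mat_def inner_commute dot_lmul_matrix transpose_matrix_vector)
  define x where "x = lti_state A B u"
  have x: "lti_trajectory A B 0 u x"
    unfolding x_def by (rule lti_state_trajectory[OF u])
  have xL: "x \<in> L2"
    by (rule lti_trajectory_in_L2[OF A x u])
  define w where "w t = supply_rate Q (C *v x t + D *v u t) (u t)" for t
  have w: "w absolutely_integrable_on {0..}"
    using supply_rate_integrable[OF lti_output_L2[OF xL u] u] by (simp add: w_def[abs_def])
  have storage: "p (x T) (x T) \<le> integral {0..T} w" if T: "0 \<le> T" for T
  proof -
    have "p (x T) (x T) = integral {0..T} (\<lambda>s. 2 * p (x s) (A *v x s + B *v u s))"
      using lti_trajectory_quadratic_form(2)[OF p psym x u T] by (simp add: bilinear_lzero[OF p])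
    also have "\<dots> \<le> integral {0..T} w"
    proof (rule integral_le)
      show "(\<lambda>s. 2 * p (x s) (A *v x s + B *v u s)) integrable_on {0..T}"
        using lti_trajectory_quadratic_form(1)[OF p psym x u T] by (rule set_lebesgue_integral_eq_integral)
      have "w absolutely_integrable_on {0..T}"
        using w by (rule absolutely_integrable_on_subinterval) auto
      then show "w integrable_on {0..T}" by (rule set_lebesgue_integral_eq_integral)
      show "2 * p (x s) (A *v x s + B *v u s) \<le> w s" for s
        using P(2) by (simp add: p_def w_def)
    qed
    finally show ?thesis .
  qed
  obtain K where K: "K > 0" "\<And>v w. norm (p v w) \<le> K * norm v * norm w"
    using bilinear_bounded_pos[OF p] by blast
  have "0 \<le> integral {0..} w"
  proof (rule ccontr)
    define I where "I = integral {0..} w"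
    assume "\<not> 0 \<le> integral {0..} w"
    then have I: "I < 0" by (simp add: I_def)
    have "eventually (\<lambda>T. integral {0..T} w < I / 2) at_top"
      using integral_halfline_limit[OF w] I by (intro order_tendstoD(2)) (auto simp: I_def)
    \<comment> \<open>A negative limit \<open>I\<close> forces the boundary term, which is at least
      -K |x T|^2, below I / 2. This keeps the state away from 0, against square
      integrability.\<close>
    then have "eventually (\<lambda>T. - I / (2 * K) \<le> (norm (x T))\<^sup>2) at_top"
      using eventually_ge_at_top[of 0]
    proof eventually_elim
      case (elim T)
      have "- (K * (norm (x T))\<^sup>2) \<le> p (x T) (x T)"
        using K(2)[of "x T" "x T"] by (simp add: power2_eq_square mult.assoc)
      also have "\<dots> \<le> I / 2" using storage[of T] elim by simp
      finally show ?case using K(1) by (simp add: field_simps)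
    qed
    moreover have "- I / (2 * K) > 0" using I K(1) by (simp add: divide_neg_pos)
    ultimately show False using L2_not_bounded_away[OF xL] by blast
  qed
  then show "0 \<le> integral {0..} (\<lambda>t. supply_rate Q (lti_system A B C D u t) (u t))"
    by (simp add: w_def[abs_def] lti_system_def[abs_def] x_def)
qed

section \<open>From the integral quadratic constraint to the matrix inequality\<close>

text \<open>Kept as a set, since the algebra is done on single costs before any infimum is taken.
  Quantifying over \<open>x\<close> admits every initial state, whereas \<open>lti_state\<close>
  starts at the origin.\<close>

definition costs ::
  "real^'m^'m \<Rightarrow> real^'n^'m \<Rightarrow> real^'m^'n \<Rightarrow> real^'n^'n \<Rightarrow> real^2^2 \<Rightarrow> real^'m \<Rightarrow> real set" where
  "costs A B C D Q x0 = {integral {0..} (\<lambda>t. supply_rate Q (C *v x t + D *v u t) (u t)) | u x.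
     u \<in> L2 \<and> lti_trajectory A B x0 u x}"

lemma costsI:
  assumes "u \<in> L2" "lti_trajectory A B x0 u x"
  shows "integral {0..} (\<lambda>t. supply_rate Q (C *v x t + D *v u t) (u t)) \<in> costs A B C D Q x0"
  using assms unfolding costs_def by blast

lemma costs_scale:
  assumes "a \<in> costs A B C D Q x0"
  shows "r\<^sup>2 * a \<in> costs A B C D Q (r *\<^sub>R x0)"
proof -
  obtain u x where a: "a = integral {0..} (\<lambda>t. supply_rate Q (C *v x t + D *v u t) (u t))"
    and u: "u \<in> L2" and x: "lti_trajectory A B x0 u x"
    using assms by (auto simp: costs_def)
  have "supply_rate Q (r *\<^sub>R y) (r *\<^sub>R v) = r\<^sup>2 * supply_rate Q y v" for y v :: "real^'n"
    by (simp add: supply_rate_def power2_eq_square algebra_simps)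
  then have "supply_rate Q (C *v (r *\<^sub>R x t) + D *v (r *\<^sub>R u t)) (r *\<^sub>R u t)
      = r\<^sup>2 * supply_rate Q (C *v x t + D *v u t) (u t)" for t
    by (simp only: matrix_vector_mult_scaleR flip: scaleR_add_right)
  then have eq: "r\<^sup>2 * a = integral {0..} (\<lambda>t. supply_rate Q (C *v (r *\<^sub>R x t) + D *v (r *\<^sub>R u t)) (r *\<^sub>R u t))"
    by (simp add: a)
  show ?thesis
    unfolding eq by (rule costsI[OF L2_scaleR[OF u] lti_trajectory_scaleR[OF x]])
qed

text \<open>The witnesses are the sum and the difference of the two trajectories; the supply rate
  satisfies the parallelogram identity at each time.\<close>

lemma costs_parallelogram:
  fixes A :: "real^'m^'m" and B :: "real^'n^'m" and C :: "real^'m^'n" and D :: "real^'n^'n"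
  assumes A: "hurwitz A" and "a \<in> costs A B C D Q x0" "b \<in> costs A B C D Q y0"
  shows "\<exists>c\<in>costs A B C D Q (x0 + y0). \<exists>d\<in>costs A B C D Q (x0 - y0). c + d = 2 * a + 2 * b"
proof -
  define w where "w x u t = supply_rate Q (C *v x t + D *v u t) (u t)"
    for x :: "real \<Rightarrow> real^'m" and u :: "real \<Rightarrow> real^'n" and t
  have w: "w x u integrable_on {0..}" if "lti_trajectory A B x0 u x" "u \<in> L2" for x0 x u
  proof -
    have "x \<in> L2" by (rule lti_trajectory_in_L2[OF A that])
    from supply_rate_integrable[OF lti_output_L2[OF this that(2)] that(2)]
    show ?thesis unfolding w_def[abs_def] by (rule set_lebesgue_integral_eq_integral)
  qed
  obtain u x where a: "a = integral {0..} (w x u)"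
    and u: "u \<in> L2" and x: "lti_trajectory A B x0 u x"
    using assms(2) by (auto simp: costs_def w_def[abs_def])
  obtain v y where b: "b = integral {0..} (w y v)"
    and v: "v \<in> L2" and y: "lti_trajectory A B y0 v y"
    using assms(3) by (auto simp: costs_def w_def[abs_def])
  let ?xp = "\<lambda>t. x t + y t" and ?up = "\<lambda>t. u t + v t"
  let ?xm = "\<lambda>t. x t - y t" and ?um = "\<lambda>t. u t - v t"
  note p = L2_add[OF u v] lti_trajectory_add[OF x y]
  note m = L2_diff[OF u v] lti_trajectory_diff[OF x y]
  have par: "supply_rate Q (f + g) (h + k) + supply_rate Q (f - g) (h - k)
      = 2 * supply_rate Q f h + 2 * supply_rate Q g k" for f g h k :: "real^'n"
    by (simp add: supply_rate_def inner_add inner_diff inner_commute algebra_simps)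
  have eq: "w ?xp ?up t + w ?xm ?um t = 2 * w x u t + 2 * w y v t" for t
  proof -
    have "C *v ?xp t + D *v ?up t = (C *v x t + D *v u t) + (C *v y t + D *v v t)"
      "C *v ?xm t + D *v ?um t = (C *v x t + D *v u t) - (C *v y t + D *v v t)"
      by (simp_all add: matrix_vector_right_distrib matrix_vector_mult_diff_distrib)
    then show ?thesis unfolding w_def by (simp only: par)
  qed
  have "((\<lambda>t. w ?xp ?up t + w ?xm ?um t) has_integral
      integral {0..} (w ?xp ?up) + integral {0..} (w ?xm ?um)) {0..}"
    by (intro has_integral_add integrable_integral w[OF p(2,1)] w[OF m(2,1)])
  moreover have "((\<lambda>t. 2 * w x u t + 2 * w y v t) has_integral 2 * a + 2 * b) {0..}"
    unfolding a b by (intro has_integral_add has_integral_mult_right integrable_integral w[OF x u] w[OF y v])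
  ultimately have "integral {0..} (w ?xp ?up) + integral {0..} (w ?xm ?um) = 2 * a + 2 * b"
    unfolding eq by (rule has_integral_unique)
  moreover have "integral {0..} (w ?xp ?up) \<in> costs A B C D Q (x0 + y0)"
    "integral {0..} (w ?xm ?um) \<in> costs A B C D Q (x0 - y0)"
    unfolding w_def[abs_def] by (rule costsI[OF p], rule costsI[OF m])
  ultimately show ?thesis by blast
qed

text \<open>Dynamic programming: follow \<open>x\<close> up to \<open>T\<close>, then any competitor
  from \<open>x T\<close>. From the origin this bounds costs below; from a general state it gives
  the principle of optimality.\<close>

lemma costs_concat:
  fixes A :: "real^'m^'m" and B :: "real^'n^'m" and C :: "real^'m^'n" and D :: "real^'n^'n"
  assumes A: "hurwitz A" and x: "lti_trajectory A B x0 u x" and u: "u \<in> L2" and T: "0 \<le> T"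
    and c: "c \<in> costs A B C D Q (x T)"
  shows "integral {0..T} (\<lambda>t. supply_rate Q (C *v x t + D *v u t) (u t)) + c \<in> costs A B C D Q x0"
proof -
  define w where "w x u t = supply_rate Q (C *v x t + D *v u t) (u t)"
    for x :: "real \<Rightarrow> real^'m" and u :: "real \<Rightarrow> real^'n" and t
  have w: "w x u absolutely_integrable_on {0..}" if "lti_trajectory A B x0 u x" "u \<in> L2" for x0 x u
  proof -
    have "x \<in> L2" by (rule lti_trajectory_in_L2[OF A that])
    from supply_rate_integrable[OF lti_output_L2[OF this that(2)] that(2)]
    show ?thesis by (simp add: w_def[abs_def])
  qed
  obtain v y where c: "c = integral {0..} (w y v)" and v: "v \<in> L2" and y: "lti_trajectory A B (x T) v y"
    using c by (auto simp: costs_def w_def[abs_def])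
  let ?z = "\<lambda>t. if t \<le> T then x t else y (t - T)" and ?v = "\<lambda>t. if t \<le> T then u t else v (t - T)"
  have "w x u absolutely_integrable_on {0..T}"
    using w[OF x u] by (rule absolutely_integrable_on_subinterval) auto
  from integral_concat(2)[OF T this w[OF y v]]
  have "integral {0..T} (w x u) + c = integral {0..} (\<lambda>t. if t \<le> T then w x u t else w y v (t - T))"
    by (simp add: c)
  also have "(\<lambda>t. if t \<le> T then w x u t else w y v (t - T)) = w ?z ?v"
    by (auto simp: w_def)
  finally have "integral {0..T} (w x u) + c = integral {0..} (w ?z ?v)" .
  moreover have "integral {0..} (w ?z ?v) \<in> costs A B C D Q x0"
    unfolding w_def by (rule costsI[OF L2_concat[OF T u v] lti_trajectory_concat[OF x y T]])
  ultimately show ?thesis by (simp add: w_def[abs_def])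
qed

lemma costs_0_nonneg:
  assumes A: "hurwitz A" and Q: "sym_mat Q" and iqc: "iqc_holds (lti_system A B C D) Q"
    and "a \<in> costs A B C D Q 0"
  shows "0 \<le> a"
proof -
  obtain u x where a: "a = integral {0..} (\<lambda>t. supply_rate Q (C *v x t + D *v u t) (u t))"
    and u: "u \<in> L2" and x: "lti_trajectory A B 0 u x"
    using assms(4) by (auto simp: costs_def)
  have "a = integral {0..} (\<lambda>t. supply_rate Q (lti_system A B C D u t) (u t))"
    unfolding a lti_system_def
    by (rule integral_cong) (use lti_trajectory_unique[OF x lti_state_trajectory[OF u]] in simp)
  then show ?thesis
    using iqc u unfolding iqc_holds_lti_iff[OF A Q] by blast
qed

text \<open>Supplies square-integrable continuous inputs with a prescribed value at time 0; a
  nonzero constant would not be square integrable.\<close>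

lemma exp_decay_L2: "(\<lambda>t. exp (- t) *\<^sub>R v) \<in> L2"
proof -
  have eq: "(norm (exp (- t) *\<^sub>R v))\<^sup>2 = (norm v)\<^sup>2 * exp (- 2 * t)" for t :: real
    by (simp add: power_mult_distrib power2_eq_square mult_exp_exp)
  have "(\<lambda>t. exp (- 2 * t)) integrable_on {0::real..}"
    using has_integral_exp_minus_to_infinity[of 2 0] by (auto simp: has_integral_integrable)
  then have "(\<lambda>t. (norm v)\<^sup>2 * exp (- 2 * t)) integrable_on {0::real..}"
    by (rule integrable_on_mult_right)
  moreover have "(\<lambda>t::real. exp (- t) *\<^sub>R v) \<in> borel_measurable (lebesgue_on {0..})"
    by (intro continuous_imp_measurable_on_sets_lebesgue continuous_intros) auto
  ultimately show ?thesis by (simp only: L2_iff eq)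
qed

lemma derivative_nonneg_at_minimum:
  fixes f :: "real \<Rightarrow> real"
  assumes "(f has_real_derivative d) (at 0 within {0..1})" "f 0 = 0" "\<And>t. 0 \<le> t \<Longrightarrow> 0 \<le> f t"
  shows "0 \<le> d"
proof (rule tendsto_lowerbound)
  show "((\<lambda>t. (f t - f 0) / (t - 0)) \<longlongrightarrow> d) (at 0 within {0..1})"
    using assms(1) by (simp add: has_field_derivative_iff)
  show "eventually (\<lambda>t. 0 \<le> (f t - f 0) / (t - 0)) (at 0 within {0..1})"
    using assms by (auto simp: eventually_at_filter)
  show "at 0 within {0..1::real} \<noteq> bot"
    by (simp add: at_within_Icc_at_right)
qed

lemma iqc_imp_lmi:
  fixes A :: "real^'m^'m" and B :: "real^'n^'m" and C :: "real^'m^'n" and D :: "real^'n^'n"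
  assumes A: "hurwitz A" and Q: "sym_mat Q" and ctrl: "controllable A B"
    and iqc: "iqc_holds (lti_system A B C D) Q"
  shows "lmi_feasible A B C D Q"
proof -
  define K where "K = costs A B C D Q"
  define S where "S x0 = Inf (K x0)" for x0
  have nonneg: "0 \<le> a" if "a \<in> K 0" for a
    using costs_0_nonneg[OF A Q iqc] that by (simp add: K_def)
  have bdd: "bdd_below (K x0)" for x0
  proof -
    obtain T u x where T: "T > 0" and u: "u \<in> L2" and x: "lti_trajectory A B 0 u x" "x T = x0"
      using ctrl unfolding controllable_def by blast
    let ?I = "integral {0..T} (\<lambda>t. supply_rate Q (C *v x t + D *v u t) (u t))"
    \<comment> \<open>This is where controllability enters: steering from the origin to
      \<open>x0\<close> costs \<open>?I\<close>, and \<open>?I + c\<close> is a cost from the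
      origin, hence nonnegative.\<close>
    have "- ?I \<le> c" if "c \<in> K x0" for c
      using nonneg costs_concat[OF A x(1) u, of T c C D Q] that x(2) T by (fastforce simp: K_def)
    then show ?thesis by (rule bdd_belowI)
  qed
  obtain k where "k \<ge> 0" and k: "\<And>x0 u x. lti_trajectory A B x0 u x \<Longrightarrow> u \<in> L2 \<Longrightarrow>
    \<bar>integral {0..} (\<lambda>t. supply_rate Q (C *v x t + D *v u t) (u t))\<bar> \<le> k * ((norm x0)\<^sup>2 + l2_inner u u)"
    using integral_supply_rate_bound[OF A, of B Q C D] by blast
  have upper: "\<exists>a\<in>K x0. a \<le> k * (norm x0)\<^sup>2" for x0
  proof -
    have 0: "(\<lambda>t. 0) \<in> (L2 :: (real \<Rightarrow> real^'n) set)"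
      using exp_decay_L2[of 0] by simp
    obtain x where x: "lti_trajectory A B x0 (\<lambda>t. 0) x"
      using lti_trajectory_exists[OF 0] .
    let ?I = "integral {0..} (\<lambda>t. supply_rate Q (C *v x t + D *v 0) 0)"
    have "?I \<in> K x0" unfolding K_def by (rule costsI[OF 0 x])
    moreover have "?I \<le> k * (norm x0)\<^sup>2"
      using k[OF x 0] by (simp add: l2_inner_def)
    ultimately show ?thesis by blast
  qed
  obtain b where b: "bilinear b" "\<And>x y. b x y = b y x" "\<And>x. S x = b x x"
    using Inf_quadratic[of K k, OF bdd nonneg _ _ upper]
      costs_parallelogram[OF A, of _ B C D Q] costs_scale[of _ A B C D Q]
    unfolding K_def[symmetric] S_def by blast
  have main: "0 \<le> supply_rate Q (C *v x0 + D *v u0) u0 + 2 * b x0 (A *v x0 + B *v u0)" for x0 u0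
  proof -
    \<comment> \<open>Any value \<open>u0\<close> is realised at time 0 by a continuous input, so
      the derivative at 0 tests the inequality at the pair (x0, u0).\<close>
    define u where "u t = exp (- t) *\<^sub>R u0" for t
    have u: "u \<in> L2" unfolding u_def by (rule exp_decay_L2)
    obtain x where x: "lti_trajectory A B x0 u x"
      using lti_trajectory_exists[OF u] .
    have x0: "x 0 = x0" by (rule lti_trajectory_initial[OF x])
    define w where "w t = supply_rate Q (C *v x t + D *v u t) (u t)" for t
    define f where "f t = A *v x t + B *v u t" for t
    \<comment> \<open>The principle of optimality says that \<phi> is nonnegative; it vanishes at 0,
      so its right derivative there is nonnegative.\<close>
    define \<phi> where "\<phi> T = integral {0..T} w + S (x T) - S x0" for T
    have contx: "continuous_on {0..1} x"
      using lti_trajectory_continuous[OF x] by (rule continuous_on_subset) auto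
    have contu: "continuous_on {0..1} u"
      unfolding u_def by (intro continuous_intros)
    note cont_mult = linear_continuous_on_compose[OF _ matrix_vector_mul_linear]
    have contf: "continuous_on {0..1} f"
      unfolding f_def by (intro continuous_intros cont_mult contx contu)
    have contw: "continuous_on {0..1} w"
      unfolding w_def supply_rate_def by (intro continuous_intros cont_mult contx contu)
    have dw: "((\<lambda>T. integral {0..T} w) has_real_derivative w 0) (at 0 within {0..1})"
      using integral_has_real_derivative[OF contw, of 0] by simp
    have "((\<lambda>T. x0 + integral {0..T} f) has_vector_derivative 0 + f 0) (at 0 within {0..1})"
      by (intro has_vector_derivative_add has_vector_derivative_const
          integral_has_vector_derivative[OF contf]) auto
    moreover have "x t = x0 + integral {0..t} f" if "t \<in> {0..1}" for t
    proof -
      have "(f has_integral x t - x0) {0..t}"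
        using x that by (simp add: lti_trajectory_def f_def[abs_def])
      then show ?thesis by (simp add: integral_unique)
    qed
    ultimately have dx: "(x has_vector_derivative f 0) (at 0 within {0..1})"
      by (intro has_vector_derivative_transform[of 0 "{0..1}" x]) auto
    interpret b: bounded_bilinear b
      using b(1) by (simp add: bilinear_conv_bounded_bilinear)
    have "((\<lambda>t. b (x t) (x t)) has_vector_derivative b (x 0) (f 0) + b (f 0) (x 0)) (at 0 within {0..1})"
      by (rule b.has_vector_derivative[OF dx dx])
    then have dS: "((\<lambda>t. S (x t)) has_real_derivative 2 * b x0 (f 0)) (at 0 within {0..1})"
      by (simp add: b(3) b(2)[of "f 0"] x0 has_real_derivative_iff_has_vector_derivative)
    \<comment> \<open>The final \<open>- 0\<close> is the derivative of the constant
      \<open>S x0\<close>, in the shape produced by \<open>DERIV_diff\<close>.\<close>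
    have "0 \<le> w 0 + 2 * b x0 (f 0) - 0"
    proof (rule derivative_nonneg_at_minimum)
      show "(\<phi> has_real_derivative w 0 + 2 * b x0 (f 0) - 0) (at 0 within {0..1})"
        unfolding \<phi>_def by (intro DERIV_diff DERIV_add dw dS DERIV_const)
      show "\<phi> 0 = 0" by (simp add: \<phi>_def x0)
      fix T :: real assume T: "0 \<le> T"
      have "S x0 - integral {0..T} w \<le> S (x T)"
        unfolding S_def[of "x T"]
      proof (rule cInf_greatest)
        show "K (x T) \<noteq> {}" using upper by blast
        fix c assume "c \<in> K (x T)"
        then have "integral {0..T} w + c \<in> K x0"
          using costs_concat[OF A x u T, of c C D Q] by (simp add: K_def w_def[abs_def])
        then have "S x0 \<le> integral {0..T} w + c"
          unfolding S_def using bdd by (rule cInf_lower)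
        then show "S x0 - integral {0..T} w \<le> c" by simp
      qed
      then show "0 \<le> \<phi> T" by (simp add: \<phi>_def)
    qed
    then show ?thesis by (simp add: w_def f_def x0 u_def)
  qed
  have "bilinear (\<lambda>x y. - b x y)"
    using b(1) unfolding bilinear_def by (auto intro: linear_compose_neg)
  then obtain P where P: "sym_mat P" "\<And>x y. x \<bullet> (P *v y) = - b x y"
    using bilinear_imp_matrix[of "\<lambda>x y. - b x y"] b(2) by metis
  have "2 * (x \<bullet> (P *v (A *v x + B *v u))) \<le> supply_rate Q (C *v x + D *v u) u" for x u
    using main[of x u] unfolding P(2) by linarith
  with P(1) show ?thesis
    unfolding lmi_feasible_iff[OF Q] by blast
qed

theorem theorem9:
  fixes A :: "real^'m^'m" and B :: "real^'n^'m" and C :: "real^'m^'n" and D :: "real^'n^'n"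
    and Q :: "real^2^2"
  assumes "minimal_realization A B C D"
    and "hurwitz A"
    and "sym_mat Q"
  shows "(lmi_feasible A B C D Q \<longrightarrow> iqc_holds (lti_system A B C D) Q) \<and>
         (lmi_feasible A B C D Q \<longrightarrow> scaled_graph (lti_system A B C D) \<subseteq> S_region Q) \<and>
         (iqc_holds (lti_system A B C D) Q \<longleftrightarrow>
            scaled_graph (lti_system A B C D) \<subseteq> S_region Q) \<and>
         (controllable A B \<longrightarrow>
            (lmi_feasible A B C D Q \<longleftrightarrow> iqc_holds (lti_system A B C D) Q) \<and>
            (lmi_feasible A B C D Q \<longleftrightarrow>
               scaled_graph (lti_system A B C D) \<subseteq> S_region Q))"
  using lmi_imp_iqc[OF assms(2,3)] iqc_imp_lmi[OF assms(2,3)] iqc_iff_scaled_graph[OF assms(2,3)]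
  by blast

end
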